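(* Let $\Omega=\mathbb{T}$, let $\nu,\alpha_1,\alpha_2,\alpha_3,\alpha_4>0$, and consider the Kolmogorov system $$\left\{\begin{array}{l} \partial_tu+u\,\partial_xu-\nu\,\partial_x\left(\dfrac{k}{\omega}\,\partial_xu\right)=0\\[1ex] \partial_t\omega+u\,\partial_x\omega-\alpha_1\,\partial_x\left(\dfrac{k}{\omega}\,\partial_x\omega\right)=-\alpha_2\,\omega^2\\[1ex] \partial_tk+u\,\partial_xk-\alpha_3\,\partial_x\left(\dfrac{k}{\omega}\,\partial_xk\right)=-k\,\omega+\alpha_4\,\dfrac{k}{\omega}\,|\partial_xu|^2 \end{array}\right.$$ for $t\geq0$ and $x\in\Omega$. Let $(u_0,\omega_0,k_0)$ be a triplet of functions belonging to $H^3(\Omega)$, with $\omega_*\leq\omega_0\leq\omega^*$ for some strictly positive constants $0<\omega_*\leq\omega^*$, and with $k_0\geq0$ such that $\sqrt{k_0}\in H^3(\Omega)$. Assume the following conditions: (i) $k_0(0)=0$; (ii) $u_0$ is odd with respect to $0$, while $\omega_0$ and $k_0$ are even with respect to $0$; (iii) $\partial_xu_0(0)<0$. Then the corresponding $H^3$ solution $(u,\omega,k)$ with initial datum $(u_0,\omega_0,k_0)$ blows up in finite time. More precisely, if the solution does not blow up first at a different place, there exists a time $t_0>0$ such that $$\lim_{t\to t_0^-}\partial_xu(t,0)=-\infty.$$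
   Context: $\mathbb{T}=[-\pi,\pi]/\sim$ is the one-dimensional torus, where $\sim$ identifies $-\pi$ and $\pi$. For initial data $(u_0,\omega_0,k_0)$ belonging to $H^3(\Omega)$, with $\omega_*\leq\omega_0\leq\omega^*$ for some constants $0<\omega_*\leq\omega^*$, and with $k_0\geq0$ such that $\sqrt{k_0}\in H^3(\Omega)$, the corresponding $H^3$ solution is the (unique) solution $(u,\omega,k)$ of the Kolmogorov system above with $(u,\omega,k)_{|t=0}=(u_0,\omega_0,k_0)$, $\omega>0$, $k\geq0$, $u,\omega,\sqrt{k}\in L^\infty([0,T];H^3(\Omega))\cap\bigcap_{s<3}C([0,T];H^s(\Omega))$ and $\sqrt{k/\omega}\,\partial_x^{4}u,\ \sqrt{k/\omega}\,\partial_x^{4}\omega,\ \sqrt{k/\omega}\,\partial_x^{4}\sqrt{k}\in L^2([0,T];L^2(\Omega))$, for all $T$ smaller than its lifespan $T^*\in(0,+\infty]$ (the supremum of the times $T$ for which such a solution exists on $[0,T]\times\Omega$). "Blows up in finite time" means $T^*<+\infty$. *)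

theory Defs
  imports "HOL-Analysis.Analysis"
begin

text \<open>
  Functions on the torus \<open>[-\<pi>, \<pi>]/\<sim>\<close> are \<open>2\<pi>\<close>-periodic functions on the real line.
\<close>

definition periodic_2pi :: "(real \<Rightarrow> real) \<Rightarrow> bool" where
  "periodic_2pi f \<longleftrightarrow> (\<forall>x. f (x + 2 * pi) = f x)"

definition L2_torus :: "(real \<Rightarrow> real) \<Rightarrow> bool" where
  "L2_torus f \<longleftrightarrow> periodic_2pi f \<and> f \<in> borel_measurable borel \<and>
     set_integrable lborel {-pi..pi} (\<lambda>x. (f x)\<^sup>2)"

definition fourier_coeff :: "(real \<Rightarrow> real) \<Rightarrow> int \<Rightarrow> complex" where
  "fourier_coeff f n = 1 / (2 * complex_of_real pi) *
     (LINT x:{-pi..pi}|lborel. complex_of_real (f x) * cis (- (of_int n * x)))"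

definition sobolev_weight :: "real \<Rightarrow> (real \<Rightarrow> real) \<Rightarrow> int \<Rightarrow> real" where
  "sobolev_weight s f n = (1 + (of_int n)\<^sup>2) powr s * (cmod (fourier_coeff f n))\<^sup>2"

text \<open>
  \<open>H\<^sup>s\<close> of the torus, for functions that are already in \<open>L\<^sup>2\<close>.  For \<open>s < 0\<close> the full space
  also contains distributions, but here \<open>H\<^sup>s\<close> with \<open>s < 0\<close> is only used for functions which lie
  in \<open>L\<^sup>2\<close> anyway.
\<close>

definition in_sobolev :: "real \<Rightarrow> (real \<Rightarrow> real) \<Rightarrow> bool" where
  "in_sobolev s f \<longleftrightarrow> L2_torus f \<and> sobolev_weight s f summable_on UNIV"

definition sobolev_norm :: "real \<Rightarrow> (real \<Rightarrow> real) \<Rightarrow> real" where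
  "sobolev_norm s f = sqrt (\<Sum>\<^sub>\<infinity>n. sobolev_weight s f n)"

text \<open>
  Elements of \<open>H\<^sup>3\<close> are evaluated and differentiated pointwise, so an element is given by its
  continuous representative (which is then automatically \<open>C\<^sup>2\<close>).
\<close>

definition H3_torus :: "(real \<Rightarrow> real) \<Rightarrow> bool" where
  "H3_torus f \<longleftrightarrow> in_sobolev 3 f \<and> continuous_on UNIV f"

text \<open>\<open>v \<in> C([0,T]; H\<^sup>s)\<close> and \<open>v \<in> L\<^sup>\<infinity>([0,T]; H\<^sup>s)\<close>, for \<open>v t x\<close> with time argument first.\<close>

definition C_sobolev :: "real \<Rightarrow> real \<Rightarrow> (real \<Rightarrow> real \<Rightarrow> real) \<Rightarrow> bool" where
  "C_sobolev T s v \<longleftrightarrow> (\<forall>t\<in>{0..T}. in_sobolev s (v t) \<and>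
     ((\<lambda>\<tau>. sobolev_norm s (\<lambda>x. v \<tau> x - v t x)) \<longlongrightarrow> 0) (at t within {0..T}))"

definition Linf_sobolev :: "real \<Rightarrow> real \<Rightarrow> (real \<Rightarrow> real \<Rightarrow> real) \<Rightarrow> bool" where
  "Linf_sobolev T s v \<longleftrightarrow>
     (\<exists>M. AE t in lborel. t \<in> {0..T} \<longrightarrow> in_sobolev s (v t) \<and> sobolev_norm s (v t) \<le> M)"

definition test_function :: "(real \<Rightarrow> real) \<Rightarrow> bool" where
  "test_function \<phi> \<longleftrightarrow> periodic_2pi \<phi> \<and> (\<forall>n x. ((deriv ^^ n) \<phi>) differentiable (at x))"

text \<open>
  \<open>g \<partial>\<^sub>x\<^sup>4 v \<in> L\<^sup>2([0,T]; L\<^sup>2)\<close> for coefficients \<open>g t\<close> and functions \<open>v t\<close> in \<open>H\<^sup>3\<close>.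
  For such \<open>v t\<close> the fourth derivative is only a distribution; it acts on the \<open>C\<^sup>2\<close> function
  \<open>g t \<phi>\<close> by \<open>\<langle>\<partial>\<^sub>x\<^sup>4 v, g \<phi>\<rangle> = \<integral> \<partial>\<^sub>x\<^sup>2 v \<partial>\<^sub>x\<^sup>2 (g \<phi>)\<close>, and the product \<open>g \<partial>\<^sub>x\<^sup>4 v\<close> is required
  to be represented by a square integrable function \<open>F\<close>.
\<close>

definition weighted_d4_L2L2 ::
    "real \<Rightarrow> (real \<Rightarrow> real \<Rightarrow> real) \<Rightarrow> (real \<Rightarrow> real \<Rightarrow> real) \<Rightarrow> bool" where
  "weighted_d4_L2L2 T g v \<longleftrightarrow> (\<exists>F :: real \<Rightarrow> real \<Rightarrow> real.
     (\<lambda>(t, x). F t x) \<in> borel_measurable borel \<and>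
     set_integrable lborel ({0..T} \<times> {-pi..pi}) (\<lambda>(t, x). (F t x)\<^sup>2) \<and>
     (AE t in lborel. t \<in> {0..T} \<longrightarrow> (\<forall>\<phi>. test_function \<phi> \<longrightarrow>
        (LINT x:{-pi..pi}|lborel. F t x * \<phi> x) =
        (LINT x:{-pi..pi}|lborel. deriv (deriv (v t)) x * deriv (deriv (\<lambda>y. g t y * \<phi> y)) x))))"

text \<open>
  The equations are required pointwise on \<open>[0,T]\<close> (with one-sided time derivatives at the end
  points).  In the regularity class below all terms other than the time derivatives are continuous
  in \<open>(t,x)\<close>, so this is the same as requiring the equations in the sense of distributions.
\<close>

definition kolmogorov_system ::
    "real \<Rightarrow> real \<Rightarrow> real \<Rightarrow> real \<Rightarrow> real \<Rightarrow> real \<Rightarrow>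
     (real \<Rightarrow> real \<Rightarrow> real) \<Rightarrow> (real \<Rightarrow> real \<Rightarrow> real) \<Rightarrow> (real \<Rightarrow> real \<Rightarrow> real) \<Rightarrow> bool" where
  "kolmogorov_system \<nu> \<alpha>1 \<alpha>2 \<alpha>3 \<alpha>4 T u \<omega> k \<longleftrightarrow>
    (\<forall>t\<in>{0..T}. \<forall>x. \<exists>ut \<omega>t kt.
       ((\<lambda>\<tau>. u \<tau> x) has_real_derivative ut) (at t within {0..T}) \<and>
       ((\<lambda>\<tau>. \<omega> \<tau> x) has_real_derivative \<omega>t) (at t within {0..T}) \<and>
       ((\<lambda>\<tau>. k \<tau> x) has_real_derivative kt) (at t within {0..T}) \<and>
       ut + u t x * deriv (u t) x
         - \<nu> * deriv (\<lambda>y. k t y / \<omega> t y * deriv (u t) y) x = 0 \<and>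
       \<omega>t + u t x * deriv (\<omega> t) x
         - \<alpha>1 * deriv (\<lambda>y. k t y / \<omega> t y * deriv (\<omega> t) y) x = - \<alpha>2 * (\<omega> t x)\<^sup>2 \<and>
       kt + u t x * deriv (k t) x
         - \<alpha>3 * deriv (\<lambda>y. k t y / \<omega> t y * deriv (k t) y) x
         = - k t x * \<omega> t x + \<alpha>4 * (k t x / \<omega> t x) * \<bar>deriv (u t) x\<bar>\<^sup>2)"

definition H3_regular :: "real \<Rightarrow> (real \<Rightarrow> real \<Rightarrow> real) \<Rightarrow> bool" where
  "H3_regular T v \<longleftrightarrow>
     (\<forall>t\<in>{0..T}. continuous_on UNIV (v t)) \<and> Linf_sobolev T 3 v \<and> (\<forall>s<3. C_sobolev T s v)"

definition H3_solution_on ::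
    "real \<Rightarrow> real \<Rightarrow> real \<Rightarrow> real \<Rightarrow> real \<Rightarrow>
     (real \<Rightarrow> real) \<Rightarrow> (real \<Rightarrow> real) \<Rightarrow> (real \<Rightarrow> real) \<Rightarrow> real \<Rightarrow>
     (real \<Rightarrow> real \<Rightarrow> real) \<Rightarrow> (real \<Rightarrow> real \<Rightarrow> real) \<Rightarrow> (real \<Rightarrow> real \<Rightarrow> real) \<Rightarrow> bool" where
  "H3_solution_on \<nu> \<alpha>1 \<alpha>2 \<alpha>3 \<alpha>4 u0 \<omega>0 k0 T u \<omega> k \<longleftrightarrow>
     u 0 = u0 \<and> \<omega> 0 = \<omega>0 \<and> k 0 = k0 \<and>
     (\<forall>t\<in>{0..T}. \<forall>x. \<omega> t x > 0 \<and> k t x \<ge> 0) \<and>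
     H3_regular T u \<and> H3_regular T \<omega> \<and> H3_regular T (\<lambda>t x. sqrt (k t x)) \<and>
     weighted_d4_L2L2 T (\<lambda>t x. sqrt (k t x / \<omega> t x)) u \<and>
     weighted_d4_L2L2 T (\<lambda>t x. sqrt (k t x / \<omega> t x)) \<omega> \<and>
     weighted_d4_L2L2 T (\<lambda>t x. sqrt (k t x / \<omega> t x)) (\<lambda>t x. sqrt (k t x)) \<and>
     kolmogorov_system \<nu> \<alpha>1 \<alpha>2 \<alpha>3 \<alpha>4 T u \<omega> k"

definition lifespan ::
    "real \<Rightarrow> real \<Rightarrow> real \<Rightarrow> real \<Rightarrow> real \<Rightarrow>
     (real \<Rightarrow> real) \<Rightarrow> (real \<Rightarrow> real) \<Rightarrow> (real \<Rightarrow> real) \<Rightarrow> ereal" where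
  "lifespan \<nu> \<alpha>1 \<alpha>2 \<alpha>3 \<alpha>4 u0 \<omega>0 k0 =
     Sup {ereal T |T. T > 0 \<and> (\<exists>u \<omega> k. H3_solution_on \<nu> \<alpha>1 \<alpha>2 \<alpha>3 \<alpha>4 u0 \<omega>0 k0 T u \<omega> k)}"

text \<open>
  \<open>(u, \<omega>, k)\<close> is the \<open>H\<^sup>3\<close> solution up to its lifespan.  Values at times beyond the lifespan
  are irrelevant.
\<close>

definition H3_solution ::
    "real \<Rightarrow> real \<Rightarrow> real \<Rightarrow> real \<Rightarrow> real \<Rightarrow>
     (real \<Rightarrow> real) \<Rightarrow> (real \<Rightarrow> real) \<Rightarrow> (real \<Rightarrow> real) \<Rightarrow>
     (real \<Rightarrow> real \<Rightarrow> real) \<Rightarrow> (real \<Rightarrow> real \<Rightarrow> real) \<Rightarrow> (real \<Rightarrow> real \<Rightarrow> real) \<Rightarrow> bool" where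
  "H3_solution \<nu> \<alpha>1 \<alpha>2 \<alpha>3 \<alpha>4 u0 \<omega>0 k0 u \<omega> k \<longleftrightarrow>
     lifespan \<nu> \<alpha>1 \<alpha>2 \<alpha>3 \<alpha>4 u0 \<omega>0 k0 > 0 \<and>
     (\<forall>T>0. ereal T < lifespan \<nu> \<alpha>1 \<alpha>2 \<alpha>3 \<alpha>4 u0 \<omega>0 k0 \<longrightarrow>
        H3_solution_on \<nu> \<alpha>1 \<alpha>2 \<alpha>3 \<alpha>4 u0 \<omega>0 k0 T u \<omega> k)"

text \<open>
  Blow-up at the place \<open>x\<close>, for a solution with lifespan \<open>Ts < \<infinity>\<close>: one of the quantities that
  have a pointwise value for \<open>H\<^sup>3\<close> functions, namely \<open>\<partial>\<^sub>x\<^sup>j u\<close>, \<open>\<partial>\<^sub>x\<^sup>j \<omega>\<close>, \<open>\<partial>\<^sub>x\<^sup>j \<surd>k\<close> with \<open>j \<le> 2\<close>,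
  is unbounded at \<open>x\<close> as time runs through \<open>[0, Ts)\<close>.
\<close>

definition blows_up_at ::
    "ereal \<Rightarrow> (real \<Rightarrow> real \<Rightarrow> real) \<Rightarrow> (real \<Rightarrow> real \<Rightarrow> real) \<Rightarrow> (real \<Rightarrow> real \<Rightarrow> real) \<Rightarrow>
     real \<Rightarrow> bool" where
  "blows_up_at Ts u \<omega> k x \<longleftrightarrow> Ts < \<infinity> \<and>
     (\<exists>v \<in> {u, \<omega>, \<lambda>t x. sqrt (k t x)}. \<exists>j\<le>2.
        \<not> bounded ((\<lambda>t. (deriv ^^ j) (v t) x) ` {t. 0 \<le> t \<and> ereal t < Ts}))"

text \<open>
  The solution blows up first at a place different from \<open>x\<close>: it ceases to exist at the finite time
  \<open>Ts\<close>, but up to that time there is no blow-up at \<open>x\<close>.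
\<close>

definition blows_up_first_away_from ::
    "ereal \<Rightarrow> (real \<Rightarrow> real \<Rightarrow> real) \<Rightarrow> (real \<Rightarrow> real \<Rightarrow> real) \<Rightarrow> (real \<Rightarrow> real \<Rightarrow> real) \<Rightarrow>
     real \<Rightarrow> bool" where
  "blows_up_first_away_from Ts u \<omega> k x \<longleftrightarrow> Ts < \<infinity> \<and> \<not> blows_up_at Ts u \<omega> k x"

end

theory Submission
  imports Defs
begin

text \<open>
  The blow-up is decided by the equations at the origin alone.
  With \<open>b = \<surd>k\<close>, the quantity \<open>u\<^sup>2 + k\<close> at \<open>x = 0\<close> satisfies a linear differential inequality, so
  \<open>u(t,0) = k(t,0) = 0\<close> as long as the solution exists. Since \<open>b \<ge> 0\<close> has a minimum at \<open>0\<close>, also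
  \<open>\<partial>\<^sub>xb(t,0) = 0\<close>; hence \<open>k = O(x\<^sup>4)\<close>, and all diffusion terms for \<open>u\<close> and \<open>\<omega>\<close> are \<open>O(x\<^sup>3)\<close> and drop out of
  the equations for the derivatives of order at most two at \<open>0\<close>. In particular
  \<open>y = \<partial>\<^sub>xu(t,0)\<close> solves \<open>y' = - y\<^sup>2\<close>, so \<open>(1 + y(0) t) y(t) = y(0)\<close> and the lifespan is at most
  \<open>- 1 / y(0)\<close>. If it is smaller, \<open>y\<close> stays bounded, and the remaining derivatives at \<open>0\<close> solve
  linear equations with bounded coefficients, so nothing blows up at \<open>0\<close>.

  Two derivatives in \<open>x\<close> exhaust the pointwise regularity of \<open>H\<^sup>3\<close> functions, so the differentiated
  equations are obtained as uniform limits of those for Taylor quotients at \<open>0\<close>. The \<open>C\<^sup>2\<close>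
  regularity itself comes from the Sobolev embedding of \<open>H\<^bsup>11/4\<^esup>\<close>, where the Fourier series of a
  continuous function is identified by the Stone-Weierstrass theorem on the circle.
\<close>

section \<open>Uniqueness of Fourier coefficients\<close>

text \<open>\<open>Arg (cis x)\<close> and \<open>x\<close> have the same sine and cosine, so they
  differ by a multiple of 2 pi. This turns periodic functions into functions on the unit
  circle.\<close>

lemma periodic_2pi_Arg:
  fixes f :: "real \<Rightarrow> 'a"
  assumes "\<And>x. f (x + 2 * pi) = f x"
  shows "f (Arg (cis x)) = f x"
proof -
  have pos: "f (y + 2 * pi * of_nat n) = f y" for y n
  proof (induction n)
    case (Suc n)
    then show ?case
      using assms[of "y + 2 * pi * of_nat n"] by (simp add: algebra_simps)
  qed simp
  have per: "f (y + 2 * pi * of_int n) = f y" for y n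
  proof (cases "n \<ge> 0")
    case True
    then show ?thesis using pos[of y "nat n"] by simp
  next
    case False
    then show ?thesis using pos[of "y + 2 * pi * of_int n" "nat (- n)"] by simp
  qed
  have "cis (Arg (cis x)) = cis x"
    by (simp add: cis_Arg sgn_eq)
  then obtain n :: int where "Arg (cis x) = x + 2 * pi * of_int n"
    using sin_cos_eq_iff[of "Arg (cis x)" x] by (auto simp: complex_eq_iff)
  then show ?thesis by (simp add: per)
qed

text \<open>Near \<open>cis x\<close>, the value at \<open>z\<close> is \<open>f (x + Arg (z / cis x))\<close>, which avoids the branch cut.\<close>

lemma continuous_on_circle_Arg:
  fixes f :: "real \<Rightarrow> 'a::topological_space"
  assumes per: "\<And>x. f (x + 2 * pi) = f x" and cont: "continuous_on UNIV f"
  shows "continuous_on (sphere 0 1) (\<lambda>z. f (Arg z))"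
  unfolding continuous_on_eq_continuous_within
proof
  fix w :: complex assume w: "w \<in> sphere 0 1"
  define x where "x = Arg w"
  have wx: "w = cis x" using w cis_Arg[of w] by (cases "w = 0") (auto simp: x_def sgn_eq)
  have eq: "f (Arg z) = f (x + Arg (z / w))" if "z \<in> sphere 0 1" for z
  proof -
    have nz: "z / w \<noteq> 0" "norm (z / w) = 1" using that w by (auto simp: norm_divide)
    have "cis (x + Arg (z / w)) = cis x * cis (Arg (z / w))" by (simp add: cis_mult)
    also have "cis (Arg (z / w)) = z / w"
      using nz cis_Arg[OF nz(1)] by (simp add: sgn_eq del: divide_eq_0_iff)
    also have "cis x * (z / w) = z" using w by (auto simp: wx)
    finally show ?thesis using periodic_2pi_Arg[of f "x + Arg (z / w)", OF per] by simp
  qed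
  have "w \<noteq> 0" using w by auto
  have "isCont f y" for y
    using cont by (simp add: continuous_on_eq_continuous_at)
  moreover have "((\<lambda>z. x + Arg (z / w)) \<longlongrightarrow> x + Arg (w / w)) (at w within sphere 0 1)"
    using \<open>w \<noteq> 0\<close>
    by (intro tendsto_intros isCont_tendsto_compose[of _ Arg] continuous_at_Arg) auto
  ultimately have "((\<lambda>z. f (x + Arg (z / w))) \<longlongrightarrow> f (x + Arg (w / w))) (at w within sphere 0 1)"
    by (rule isCont_tendsto_compose)
  then have "((\<lambda>z. f (Arg z)) \<longlongrightarrow> f (Arg w)) (at w within sphere 0 1)"
    using w by (auto simp: eq intro: Lim_transform_within[where d = 1])
  then show "continuous (at w within sphere 0 1) (\<lambda>z. f (Arg z))"
    by (simp add: continuous_within)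
qed

lemma integral_cis_int:
  "((\<lambda>x. cis (of_int n * x)) has_integral (if n = 0 then 2 * pi else 0)) {-pi..pi}"
proof (cases "n = 0")
  case True
  have "((\<lambda>x::real. 1 :: complex) has_integral (2 * pi) *\<^sub>R 1) {-pi..pi}"
    using has_integral_const_real[of "1::complex" "-pi" pi] by simp
  then show ?thesis using True by (simp add: scaleR_conv_of_real)
next
  case False
  have "((\<lambda>x. cis (of_int n * x)) has_integral
      (cis (of_int n * pi) / (\<i> * of_int n) - cis (of_int n * (-pi)) / (\<i> * of_int n))) {-pi..pi}"
  proof (rule fundamental_theorem_of_calculus)
    fix x assume "x \<in> {-pi..pi}"
    have "(\<lambda>x. cis (of_int n * x) / (\<i> * of_int n)) =
        (\<lambda>x. Complex (sin (of_int n * x) / of_int n) (- cos (of_int n * x) / of_int n))"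
      by (auto simp: complex_eq_iff fun_eq_iff Re_divide Im_divide power2_eq_square)
    moreover have "((\<lambda>x. Complex (sin (of_int n * x) / of_int n) (- cos (of_int n * x) / of_int n))
        has_vector_derivative cis (of_int n * x)) (at x within {-pi..pi})"
      using False
      by (auto simp: has_vector_derivative_complex_iff intro!: derivative_eq_intros)
    ultimately show "((\<lambda>x. cis (of_int n * x) / (\<i> * of_int n)) has_vector_derivative
        cis (of_int n * x)) (at x within {-pi..pi})"
      by simp
  qed simp
  moreover have "cis (of_int n * pi) = cis (of_int n * (-pi))"
    by (simp add: complex_eq_iff sin_int_times_real mult.commute)
  ultimately show ?thesis using False by simp
qed

section \<open>Trigonometric polynomials and their density\<close>

inductive trig_polynomial :: "(real \<Rightarrow> complex) \<Rightarrow> bool" where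
  monomial: "trig_polynomial (\<lambda>x. c * cis (of_int n * x))"
| add: "trig_polynomial p \<Longrightarrow> trig_polynomial q \<Longrightarrow> trig_polynomial (\<lambda>x. p x + q x)"

lemma trig_polynomial_mult:
  assumes "trig_polynomial p" "trig_polynomial q"
  shows "trig_polynomial (\<lambda>x. p x * q x)"
  using assms(1)
proof induction
  case (monomial c n)
  from assms(2) show ?case
  proof induction
    case (monomial d m)
    have "(\<lambda>x. c * cis (of_int n * x) * (d * cis (of_int m * x)))
        = (\<lambda>x. (c * d) * cis (of_int (n + m) * x))"
      by (simp add: fun_eq_iff cis_mult algebra_simps flip: cis_mult)
    then show ?case by (metis trig_polynomial.monomial)
  next
    case (add p q)
    then show ?case by (simp only: distrib_left trig_polynomial.add)
  qed
next
  case (add p q)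
  then show ?case by (simp only: distrib_right trig_polynomial.add)
qed

text \<open>A linear functional of \<open>cis x\<close> is a combination of cosine and sine, hence
  of the frequencies 1 and -1; sums and products stay in the class. So the approximants that
  Stone-Weierstrass gives on the circle can be integrated against Fourier modes.\<close>

lemma trig_polynomial_real_polynomial:
  assumes "real_polynomial_function p"
  shows "trig_polynomial (\<lambda>x. complex_of_real (p (cis x)))"
  using assms
proof induction
  case (linear f)
  then interpret bounded_linear f .
  define a where "a = f 1"
  define b where "b = f \<i>"
  have "f (cis x) = a * cos x + b * sin x" for x
  proof -
    have "cis x = cos x *\<^sub>R 1 + sin x *\<^sub>R \<i>" by (simp add: complex_eq_iff)
    then show ?thesis by (simp add: add scaleR a_def b_def)
  qed
  then have "complex_of_real (f (cis x)) = Complex (a/2) (-b/2) * cis (of_int 1 * x)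
      + Complex (a/2) (b/2) * cis (of_int (-1) * x)" for x
    by (simp add: complex_eq_iff algebra_simps)
  then show ?case by (simp only: trig_polynomial.intros)
next
  case (const c)
  have "trig_polynomial (\<lambda>x. of_real c * cis (of_int 0 * x))"
    by (rule trig_polynomial.monomial)
  then show ?case by simp
next
  case (add f g)
  then show ?case by (simp only: of_real_add trig_polynomial.add)
next
  case (mult f g)
  then show ?case by (simp only: of_real_mult trig_polynomial_mult)
qed

text \<open>Vanishing coefficients make \<open>h\<close> orthogonal to every trigonometric
  polynomial. If a real one, \<open>g\<close>, lies within \<open>e\<close> of
  \<open>r = Re h\<close>, then the integral of r^2 equals that of r (r - g), which is at most
  \<open>e\<close> times the integral of |r|. Letting \<open>e\<close> tend to 0 and using
  continuity gives \<open>r = 0\<close>.\<close>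

lemma Re_zero_of_fourier_zero:
  fixes h :: "real \<Rightarrow> complex"
  assumes per: "\<And>x. h (x + 2 * pi) = h x" and cont: "continuous_on UNIV h"
    and zero: "\<And>n::int. integral {-pi..pi} (\<lambda>x. h x * cis (of_int n * x)) = 0"
  shows "Re (h x) = 0"
proof -
  have contS: "continuous_on S h" for S using cont continuous_on_subset by blast
  have trig0: "((\<lambda>x. h x * p x) has_integral 0) {-pi..pi}" if "trig_polynomial p" for p
    using that
  proof induction
    case (monomial c n)
    have "(\<lambda>x. h x * cis (of_int n * x)) integrable_on {-pi..pi}"
      by (intro integrable_continuous_real continuous_intros contS)
    then have "((\<lambda>x. h x * cis (of_int n * x)) has_integral 0) {-pi..pi}"
      using zero[of n] by (simp add: has_integral_integral)
    from has_integral_mult_right[OF this, of c] show ?case by (simp add: algebra_simps)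
  next
    case (add p q)
    from has_integral_add[OF add.IH] show ?case by (simp add: algebra_simps)
  qed
  define r where "r x = Re (h x)" for x
  have contr: "continuous_on S r" for S unfolding r_def by (intro continuous_intros contS)
  define I where "I = integral {-pi..pi} (\<lambda>x. (r x)\<^sup>2)"
  have I: "((\<lambda>x. (r x)\<^sup>2) has_integral I) {-pi..pi}"
    unfolding I_def by (intro integrable_integral integrable_continuous_real continuous_intros contr)
  define J where "J = integral {-pi..pi} (\<lambda>x. \<bar>r x\<bar>)"
  have J: "((\<lambda>x. \<bar>r x\<bar>) has_integral J) {-pi..pi}"
    unfolding J_def by (intro integrable_integral integrable_continuous_real continuous_intros contr)
  have "J \<ge> 0" using J by (rule has_integral_nonneg) auto
  have le: "I \<le> e * J" if "e > 0" for e
  proof -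
    have "continuous_on (sphere 0 1) (\<lambda>z::complex. r (Arg z))"
      by (rule continuous_on_circle_Arg) (auto simp: r_def per contr[unfolded r_def])
    then obtain g where g: "real_polynomial_function g"
      and gb: "\<And>z::complex. z \<in> sphere 0 1 \<Longrightarrow> \<bar>r (Arg z) - g z\<bar> < e"
      using Stone_Weierstrass_real_polynomial_function[OF compact_sphere _ \<open>e > 0\<close>] by blast
    have gr: "\<bar>r x - g (cis x)\<bar> \<le> e" for x
      using gb[of "cis x"] periodic_2pi_Arg[of r x] by (auto simp: r_def per)
    have "((\<lambda>x. r x * g (cis x)) has_integral 0) {-pi..pi}"
      using has_integral_linear[OF trig0[OF trig_polynomial_real_polynomial[OF g]] bounded_linear_Re]
      by (simp add: o_def r_def)
    from has_integral_diff[OF I this]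
    have "((\<lambda>x. r x * (r x - g (cis x))) has_integral I) {-pi..pi}"
      by (simp add: algebra_simps power2_eq_square)
    moreover have "((\<lambda>x. e * \<bar>r x\<bar>) has_integral e * J) {-pi..pi}"
      by (rule has_integral_mult_right[OF J])
    moreover have "r x * (r x - g (cis x)) \<le> e * \<bar>r x\<bar>" for x
    proof -
      have "r x * (r x - g (cis x)) \<le> \<bar>r x\<bar> * \<bar>r x - g (cis x)\<bar>"
        by (metis abs_ge_self abs_mult)
      also have "\<dots> \<le> \<bar>r x\<bar> * e" by (intro mult_left_mono gr) auto
      finally show ?thesis by (simp add: mult.commute)
    qed
    ultimately show ?thesis by (rule has_integral_le)
  qed
  have "I \<le> 0"
  proof (rule field_le_epsilon)
    fix e :: real assume "e > 0"
    \<comment> \<open>The denominator \<open>J + 1\<close> also covers \<open>J = 0\<close>.\<close>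
    have "I \<le> e / (J + 1) * J" using \<open>e > 0\<close> \<open>J \<ge> 0\<close> by (intro le) auto
    also have "\<dots> \<le> e" using \<open>e > 0\<close> \<open>J \<ge> 0\<close> by (simp add: field_simps)
    finally show "I \<le> 0 + e" by simp
  qed
  moreover have "I \<ge> 0" using I by (rule has_integral_nonneg) auto
  ultimately have "((\<lambda>x. (r x)\<^sup>2) has_integral 0) (cbox (-pi) pi)" using I by simp
  moreover have "continuous_on (cbox (-pi) pi) (\<lambda>x. (r x)\<^sup>2)"
    by (intro continuous_intros contr)
  ultimately have 0: "(r x)\<^sup>2 = 0" if "x \<in> cbox (-pi) pi" for x
    using has_integral_0_cbox_imp_0[of "-pi" pi "\<lambda>x. (r x)\<^sup>2" x] that pi_gt_zero
    by (simp del: pi_gt_zero)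
  have "r (Arg (cis x)) = 0" using 0[of "Arg (cis x)"] Arg_bounded[of "cis x"] by auto
  then show ?thesis using periodic_2pi_Arg[of r x] by (auto simp: r_def per)
qed

section \<open>Fourier series\<close>

lemma fourier_coeff_continuous:
  assumes "continuous_on UNIV f"
  shows "fourier_coeff f n = 1 / (2 * complex_of_real pi) *
    integral {-pi..pi} (\<lambda>x. complex_of_real (f x) * cis (- (of_int n * x)))"
proof -
  have "continuous_on {-pi..pi} (\<lambda>x. complex_of_real (f x) * cis (- (of_int n * x)))"
    by (intro continuous_intros continuous_on_subset[OF assms]) auto
  then show ?thesis
    unfolding fourier_coeff_def
    by (subst set_borel_integral_eq_integral) (auto intro: borel_integrable_atLeastAtMost')
qed

lemma fourier_coeff_diff:
  assumes "continuous_on UNIV f" "continuous_on UNIV g"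
  shows "fourier_coeff (\<lambda>x. f x - g x) n = fourier_coeff f n - fourier_coeff g n"
proof -
  have *: "(\<lambda>x. complex_of_real (h x) * cis (- (of_int n * x))) integrable_on {-pi..pi}"
    if "continuous_on UNIV h" for h
    by (intro integrable_continuous_real continuous_intros continuous_on_subset[OF that]) auto
  have "continuous_on UNIV (\<lambda>x. f x - g x)" by (intro continuous_intros assms)
  then show ?thesis
    by (simp add: fourier_coeff_continuous assms left_diff_distrib diff_divide_distrib
        Henstock_Kurzweil_Integration.integral_diff *)
qed

text \<open>The infinite sum in \<open>sobolev_norm\<close> defaults to 0 when it does not converge,
  so a small norm of a difference carries information only once the difference is known to lie in
  the space.\<close>

lemma in_sobolev_diff:
  assumes "continuous_on UNIV f" "continuous_on UNIV g" "in_sobolev s f" "in_sobolev s g"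
  shows "in_sobolev s (\<lambda>x. f x - g x)"
proof -
  have cont: "continuous_on UNIV (\<lambda>x. f x - g x)" by (intro continuous_intros assms)
  have "continuous_on {-pi..pi} (\<lambda>x. (f x - g x)\<^sup>2)"
    by (intro continuous_intros continuous_on_subset[OF assms(1)]
        continuous_on_subset[OF assms(2)]) auto
  then have "L2_torus (\<lambda>x. f x - g x)"
    using assms borel_measurable_continuous_onI[OF cont]
    by (auto simp: L2_torus_def in_sobolev_def periodic_2pi_def
        intro: borel_integrable_atLeastAtMost')
  moreover have "sobolev_weight s (\<lambda>x. f x - g x) summable_on UNIV"
  proof (rule summable_on_comparison_test)
    show "(\<lambda>n. 2 * sobolev_weight s f n + 2 * sobolev_weight s g n) summable_on UNIV"
      using assms unfolding in_sobolev_def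
      by (intro summable_on_add summable_on_cmult_right) auto
    fix n
    have "(cmod (a - b))\<^sup>2 \<le> 2 * (cmod a)\<^sup>2 + 2 * (cmod b)\<^sup>2" for a b
    proof -
      have "(cmod (a - b))\<^sup>2 \<le> (cmod a + cmod b)\<^sup>2"
        by (intro power_mono norm_triangle_ineq4) auto
      also have "\<dots> \<le> 2 * (cmod a)\<^sup>2 + 2 * (cmod b)\<^sup>2"
        using sum_squares_bound[of "cmod a" "cmod b"] by (simp add: power2_sum)
      finally show ?thesis .
    qed
    from mult_left_mono[OF this[of "fourier_coeff f n" "fourier_coeff g n"],
        of "(1 + (of_int n)\<^sup>2) powr s"]
    show "sobolev_weight s (\<lambda>x. f x - g x) n \<le> 2 * sobolev_weight s f n + 2 * sobolev_weight s g n"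
      by (simp add: sobolev_weight_def fourier_coeff_diff assms algebra_simps)
  qed (auto simp: sobolev_weight_def)
  ultimately show ?thesis by (simp add: in_sobolev_def)
qed

text \<open>The frequencies form a sequence over the naturals, later given by
  \<open>int_decode\<close>, so that sums over the integers become ordinary series and
  differentiation just multiplies \<open>c m\<close> by \<open>\<i> * n m\<close>.\<close>

definition trig_series :: "(nat \<Rightarrow> complex) \<Rightarrow> (nat \<Rightarrow> real) \<Rightarrow> real \<Rightarrow> real" where
  "trig_series c n x = (\<Sum>m. Re (c m * cis (n m * x)))"

lemma trig_term_le: "\<bar>Re (c * cis y)\<bar> \<le> cmod c"
  using abs_Re_le_cmod[of "c * cis y"] by (simp add: norm_mult)

lemma abs_trig_series_le:
  assumes "summable b" "\<And>m. cmod (c m) \<le> b m"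
  shows "\<bar>trig_series c n x\<bar> \<le> suminf b"
proof -
  have "norm (suminf (\<lambda>m. Re (c m * cis (n m * x)))) \<le> suminf b"
    using trig_term_le assms order_trans by (intro norm_suminf_le) fastforce+
  then show ?thesis by (simp add: trig_series_def)
qed

lemma uniform_limit_trig_series:
  assumes "summable (\<lambda>m. cmod (c m))"
  shows "uniform_limit UNIV (\<lambda>N x. \<Sum>m<N. Re (c m * cis (n m * x))) (trig_series c n) sequentially"
  using Weierstrass_m_test[of UNIV "\<lambda>m x. Re (c m * cis (n m * x))", OF _ assms] trig_term_le
  by (simp add: trig_series_def[abs_def])

lemma continuous_on_trig_series:
  assumes "summable (\<lambda>m. cmod (c m))"
  shows "continuous_on UNIV (trig_series c n)"
  by (rule uniform_limit_theorem[OF _ uniform_limit_trig_series[OF assms]])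
    (auto intro!: always_eventually continuous_intros)

lemma has_derivative_trig_series:
  assumes "summable (\<lambda>m. cmod (c m))" "summable (\<lambda>m. \<bar>n m\<bar> * cmod (c m))"
  shows "(trig_series c n has_real_derivative trig_series (\<lambda>m. \<i> * n m * c m) n x) (at x)"
proof -
  let ?f' = "\<lambda>m x. Re ((\<i> * n m * c m) * cis (n m * x))"
  have "uniformly_convergent_on UNIV (\<lambda>N x. \<Sum>m<N. ?f' m x)"
    using uniform_limit_trig_series[of "\<lambda>m. \<i> * n m * c m" n] assms(2)
    by (auto simp: uniformly_convergent_on_def norm_mult)
  moreover have "summable (\<lambda>m. Re (c m * cis (n m * 0)))"
    by (intro summable_comparison_test'[OF assms(1)]) (auto simp: abs_Re_le_cmod)
  moreover have "((\<lambda>x. Re (c m * cis (n m * x))) has_field_derivative ?f' m x) (at x)" for m x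
    by (auto intro!: derivative_eq_intros simp: algebra_simps)
  ultimately show ?thesis
    using has_field_derivative_series'(2)[of UNIV "\<lambda>m x. Re (c m * cis (n m * x))" ?f' 0 x]
    by (simp add: trig_series_def[abs_def])
qed

text \<open>The weight dominates 1, |n| and n^2, so one summable sequence controls the Fourier
  series of \<open>f\<close> and of its first two derivatives.\<close>

definition fourier_mass :: "(real \<Rightarrow> real) \<Rightarrow> nat \<Rightarrow> real" where
  "fourier_mass f m = (1 + (of_int (int_decode m))\<^sup>2) * cmod (fourier_coeff f (int_decode m))"

text \<open>Absolute summability makes the series converge uniformly, so its coefficients can be
  computed term by term and agree with those of \<open>f\<close>. The difference has only zero
  coefficients, hence its real part vanishes.\<close>

lemma fourier_series:
  assumes per: "periodic_2pi f" and cont: "continuous_on UNIV f" and sm: "summable (fourier_mass f)"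
  shows "f x = trig_series (\<lambda>m. fourier_coeff f (int_decode m)) (\<lambda>m. of_int (int_decode m)) x"
proof -
  define c where "c m = fourier_coeff f (int_decode m)" for m
  define \<phi> where "\<phi> m x = c m * cis (of_int (int_decode m) * x)" for m x
  define g where "g x = (\<Sum>m. \<phi> m x)" for x
  have sc: "summable (\<lambda>m. cmod (c m))"
    by (rule summable_comparison_test'[OF sm, of 0]) (auto simp: fourier_mass_def c_def algebra_simps)
  have sphi: "summable (\<lambda>m. \<phi> m x)" for x
    by (rule summable_comparison_test'[OF sc, of 0]) (auto simp: \<phi>_def norm_mult)
  have ul: "uniform_limit A (\<lambda>N x. \<Sum>m<N. \<phi> m x) g sequentially" for A
    unfolding g_def using sc by (intro Weierstrass_m_test) (auto simp: \<phi>_def norm_mult)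
  have contg: "continuous_on UNIV g"
    by (rule uniform_limit_theorem[OF _ ul])
      (auto intro!: always_eventually continuous_intros simp: \<phi>_def)
  have perphi: "\<phi> m (x + 2 * pi) = \<phi> m x" for m x
  proof -
    have "cis (of_int (int_decode m) * (x + 2 * pi)) = cis (of_int (int_decode m) * x) * cis (2 * pi * of_int (int_decode m))"
      by (simp add: cis_mult algebra_simps)
    then show ?thesis by (simp add: \<phi>_def)
  qed
  \<comment> \<open>Testing with frequency \<open>j\<close> picks out coefficient
    \<open>- j\<close>, because \<open>fourier_coeff\<close> integrates against the conjugate
    mode.\<close>
  have coeff: "((\<lambda>x. g x * cis (of_int j * x)) has_integral 2 * pi * fourier_coeff f (- j)) {-pi..pi}" for j
  proof -
    have "uniform_limit {-pi..pi} (\<lambda>N x. (\<Sum>m<N. \<phi> m x) * cis (of_int j * x))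
        (\<lambda>x. g x * cis (of_int j * x)) sequentially"
    proof (rule uniform_lim_mult[OF ul])
      show "uniform_limit {- pi..pi} (\<lambda>a x. cis (real_of_int j * x)) (\<lambda>a. cis (real_of_int j * a)) sequentially"
        by (rule uniform_limit_const)
      show "bounded (g ` {-pi..pi})"
        by (intro compact_imp_bounded compact_continuous_image continuous_on_subset[OF contg]) auto
      show "bounded ((\<lambda>a. cis (real_of_int j * a)) ` {-pi..pi})"
        by (auto simp: bounded_iff)
    qed
    then obtain I J where I: "\<And>N. ((\<lambda>x. (\<Sum>m<N. \<phi> m x) * cis (of_int j * x)) has_integral I N) {-pi..pi}"
      and J: "((\<lambda>x. g x * cis (of_int j * x)) has_integral J) {-pi..pi}" and IJ: "I \<longlonglongrightarrow> J"
      by (rule uniform_limit_integral) (auto intro!: continuous_intros simp: \<phi>_def)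
    have "((\<lambda>x. \<phi> m x * cis (of_int j * x)) has_integral
        c m * complex_of_real (if int_decode m + j = 0 then 2 * pi else 0)) {-pi..pi}" for m
      using has_integral_mult_right[OF integral_cis_int[of "int_decode m + j"], of "c m"]
      by (simp add: \<phi>_def cis_mult algebra_simps flip: cis_mult)
    from has_integral_sum[OF finite_lessThan this]
    have "((\<lambda>x. (\<Sum>m<N. \<phi> m x) * cis (of_int j * x)) has_integral
        (\<Sum>m<N. c m * complex_of_real (if int_decode m + j = 0 then 2 * pi else 0))) {-pi..pi}" for N
      by (simp add: sum_distrib_right)
    then have "I = (\<lambda>N. \<Sum>m<N. c m * complex_of_real (if int_decode m + j = 0 then 2 * pi else 0))"
      using I has_integral_unique by blast
    then have "(\<lambda>m. c m * complex_of_real (if int_decode m + j = 0 then 2 * pi else 0)) sums J"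
      using IJ unfolding sums_def by simp
    moreover have "int_decode m + j = 0 \<longleftrightarrow> m = int_encode (- j)" for m
      by (metis add.inverse_unique add.commute add.right_inverse int_decode_inverse int_encode_inverse)
    then have "(\<lambda>m. c m * complex_of_real (if int_decode m + j = 0 then 2 * pi else 0)) =
        (\<lambda>m. if m = int_encode (- j) then c m * complex_of_real (2 * pi) else 0)"
      by auto
    ultimately have "(\<lambda>m. if m = int_encode (- j) then c m * complex_of_real (2 * pi) else 0) sums J"
      by simp
    then have "J = c (int_encode (- j)) * complex_of_real (2 * pi)"
      using sums_single[of "int_encode (- j)" "\<lambda>m. c m * complex_of_real (2 * pi)"] sums_unique2 by blast
    then show ?thesis using J by (simp add: c_def mult.commute)
  qed
  have "Re (complex_of_real (f x) - g x) = 0"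
  proof (rule Re_zero_of_fourier_zero)
    show "complex_of_real (f (x + 2 * pi)) - g (x + 2 * pi) = complex_of_real (f x) - g x" for x
      using per by (simp add: periodic_2pi_def g_def perphi)
    show "continuous_on UNIV (\<lambda>x. complex_of_real (f x) - g x)"
      by (intro continuous_intros cont contg)
    fix j :: int
    have "((\<lambda>x. complex_of_real (f x) * cis (of_int j * x)) has_integral
        2 * pi * fourier_coeff f (- j)) {-pi..pi}"
    proof -
      have "(\<lambda>x. complex_of_real (f x) * cis (of_int j * x)) integrable_on {-pi..pi}"
        by (intro integrable_continuous_real continuous_intros continuous_on_subset[OF cont]) auto
      then show ?thesis
        by (simp add: fourier_coeff_continuous[OF cont] has_integral_integral)
    qed
    from has_integral_diff[OF this coeff[of j]]
    show "integral {-pi..pi} (\<lambda>x. (complex_of_real (f x) - g x) * cis (of_int j * x)) = 0"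
      by (simp add: left_diff_distrib integral_unique)
  qed
  then have "f x = Re (g x)" by simp
  also have "\<dots> = (\<Sum>m. Re (\<phi> m x))" unfolding g_def by (rule Re_suminf[OF sphi])
  finally show ?thesis by (simp add: trig_series_def \<phi>_def c_def)
qed

section \<open>Sobolev embedding\<close>

text \<open>The exponent is 2 - 11/4: it is what remains when (1 + n^2)^2 is split against the
  weight of H^(11/4). The terms decay like |n|^(-3/2); convergence is where a smoothness above 5/2
  enters, and 11/4 lies between 5/2 and 3.\<close>

definition decay_const :: real where
  "decay_const = (\<Sum>m. (1 + (of_int (int_decode m))\<^sup>2) powr (-3/4))"

lemma summable_decay: "summable (\<lambda>m. (1 + (of_int (int_decode m))\<^sup>2 :: real) powr (-3/4))"
proof (rule summable_comparison_test')
  have "summable (\<lambda>m. real m powr (-3/2))" by (simp add: summable_real_powr_iff)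
  then have "summable (\<lambda>m. real (Suc m) powr (-3/2))" by (subst summable_Suc_iff)
  then show "summable (\<lambda>m. 8 powr (3/4) * real (Suc m) powr (-3/2))" by (rule summable_mult)
  fix m :: nat
  define j where "j = int_decode m"
  have "m = int_encode j" by (simp add: j_def)
  \<comment> \<open>\<open>int_encode\<close> sends a nonnegative \<open>j\<close> to
    \<open>2 * j\<close> and a negative \<open>j\<close> to \<open>- 2 * j - 1\<close>.\<close>
  then have "real m \<le> 2 * \<bar>of_int j\<bar>"
    by (auto simp: int_encode_def sum_encode_def)
  then have "(real (Suc m))\<^sup>2 \<le> (2 * (\<bar>of_int j\<bar> + 1))\<^sup>2"
    by (intro power_mono) auto
  also have "\<dots> \<le> 8 * (1 + (of_int j)\<^sup>2)"
    using sum_squares_bound[of "\<bar>of_int j\<bar> :: real" 1] by (simp add: power2_eq_square algebra_simps)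
  finally have "(real (Suc m))\<^sup>2 / 8 \<le> 1 + (of_int j)\<^sup>2" by simp
  then have "(1 + (of_int j)\<^sup>2 :: real) powr (-3/4) \<le> ((real (Suc m))\<^sup>2 / 8) powr (-3/4)"
    by (intro powr_mono2') auto
  also have "\<dots> = ((real (Suc m)) powr 2) powr (-3/4) / 8 powr (-3/4)"
    by (subst powr_divide) auto
  also have "\<dots> = 8 powr (3/4) * real (Suc m) powr (-3/2)"
    by (simp add: powr_powr powr_minus_divide del: powr_numeral)
  finally show "norm ((1 + (of_int (int_decode m))\<^sup>2 :: real) powr (-3/4)) \<le> 8 powr (3/4) * real (Suc m) powr (-3/2)"
    by (simp add: j_def)
qed

lemma decay_const_nonneg: "decay_const \<ge> 0"
  unfolding decay_const_def by (rule suminf_nonneg[OF summable_decay]) auto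

lemma weighted_am_gm:
  fixes a b l :: real
  assumes "l > 0"
  shows "a * b \<le> l * a\<^sup>2 + b\<^sup>2 / l"
proof -
  have "0 \<le> (l * a - b)\<^sup>2 / l + l * a\<^sup>2 + b\<^sup>2 / l" using assms by simp
  also have "\<dots> = 2 * (l * a\<^sup>2 + b\<^sup>2 / l - a * b)"
    using assms by (simp add: field_simps power2_eq_square)
  finally show ?thesis by simp
qed

text \<open>Each term factors as (1 + n^2)^(-3/8) times (1 + n^2)^(11/8) |c_n|, and the weighted
  arithmetic-geometric inequality is applied termwise in place of Cauchy-Schwarz. The parameter
  \<open>l\<close> stays free: a small \<open>l\<close> shrinks the first summand, after which a
  small norm shrinks the second.\<close>

lemma fourier_mass_bound:
  assumes "in_sobolev (11/4) f" "l > 0"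
  shows "summable (fourier_mass f)"
    and "suminf (fourier_mass f) \<le> l * decay_const + (sobolev_norm (11/4) f)\<^sup>2 / l"
proof -
  let ?w = "\<lambda>m. sobolev_weight (11/4) f (int_decode m)"
  let ?d = "\<lambda>m. (1 + (of_int (int_decode m))\<^sup>2 :: real) powr (-3/4)"
  have bij: "bij_betw int_decode UNIV UNIV" by (rule bij_int_decode)
  have w0: "sobolev_weight (11/4) f n \<ge> 0" for n by (simp add: sobolev_weight_def)
  have "(sobolev_weight (11/4) f has_sum (\<Sum>\<^sub>\<infinity>n. sobolev_weight (11/4) f n)) UNIV"
    using assms by (simp add: in_sobolev_def)
  then have "(?w has_sum (\<Sum>\<^sub>\<infinity>n. sobolev_weight (11/4) f n)) UNIV"
    using has_sum_reindex_bij_betw[OF bij] by blast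
  moreover have "(\<Sum>\<^sub>\<infinity>n. sobolev_weight (11/4) f n) = (sobolev_norm (11/4) f)\<^sup>2"
    using w0 by (simp add: sobolev_norm_def infsum_nonneg)
  ultimately have w: "?w sums (sobolev_norm (11/4) f)\<^sup>2"
    using has_sum_imp_sums by force
  have le: "fourier_mass f m \<le> l * ?d m + ?w m / l" for m
  proof -
    define x :: real where "x = 1 + (of_int (int_decode m))\<^sup>2"
    define c where "c = cmod (fourier_coeff f (int_decode m))"
    have x: "x > 0" by (simp add: x_def add_pos_nonneg)
    have "fourier_mass f m = x powr (-3/8) * (x powr (11/8) * c)"
      using x by (simp add: fourier_mass_def x_def c_def flip: powr_add mult.assoc)
    also have "\<dots> \<le> l * (x powr (-3/8))\<^sup>2 + (x powr (11/8) * c)\<^sup>2 / l"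
      by (rule weighted_am_gm[OF assms(2)])
    also have "\<dots> = l * ?d m + ?w m / l"
      using x by (simp add: x_def c_def sobolev_weight_def power_mult_distrib power2_eq_square flip: powr_add)
    finally show ?thesis .
  qed
  have sm: "(\<lambda>m. l * ?d m + ?w m / l) sums (l * decay_const + (sobolev_norm (11/4) f)\<^sup>2 / l)"
    unfolding decay_const_def
    by (intro sums_add sums_mult sums_divide w summable_sums summable_decay)
  show 1: "summable (fourier_mass f)"
    using le by (intro summable_comparison_test'[OF sums_summable[OF sm]])
      (auto simp: fourier_mass_def)
  show "suminf (fourier_mass f) \<le> l * decay_const + (sobolev_norm (11/4) f)\<^sup>2 / l"
    using suminf_le[OF le 1 sums_summable[OF sm]] sums_unique[OF sm] by simp
qed

text \<open>The Fourier series may be differentiated twice term by term, since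
  \<open>fourier_mass\<close> majorizes the coefficients of both derived series; the same majorant
  gives the bounds.\<close>

lemma sobolev_embedding_C2:
  assumes cont: "continuous_on UNIV f" and sob: "in_sobolev (11/4) f"
  shows "(f has_real_derivative deriv f x) (at x)"
    and "(deriv f has_real_derivative deriv (deriv f) x) (at x)"
    and "continuous_on UNIV (deriv (deriv f))"
    and "\<bar>f x\<bar> \<le> suminf (fourier_mass f)"
    and "\<bar>deriv f x\<bar> \<le> suminf (fourier_mass f)"
    and "\<bar>deriv (deriv f) x\<bar> \<le> suminf (fourier_mass f)"
proof -
  define n :: "nat \<Rightarrow> real" where "n m = of_int (int_decode m)" for m
  define c where "c m = fourier_coeff f (int_decode m)" for m
  define c1 where "c1 = (\<lambda>m. \<i> * n m * c m)"
  define c2 where "c2 = (\<lambda>m. \<i> * n m * c1 m)"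
  have sm: "summable (fourier_mass f)" using fourier_mass_bound(1)[OF sob zero_less_one] .
  have n1: "\<bar>n m\<bar> \<le> 1 + (n m)\<^sup>2" for m
    using sum_squares_bound[of "\<bar>n m\<bar>" 1] by (simp; linarith)
  have mass: "fourier_mass f m = (1 + (n m)\<^sup>2) * cmod (c m)" for m
    by (simp add: fourier_mass_def n_def c_def)
  have l0: "cmod (c m) \<le> fourier_mass f m" for m
    unfolding mass by (simp add: algebra_simps)
  have l1: "cmod (c1 m) \<le> fourier_mass f m" for m
    using mult_right_mono[OF n1, of "cmod (c m)" m] by (simp add: mass c1_def norm_mult)
  have l2: "cmod (c2 m) \<le> fourier_mass f m" for m
    by (simp add: mass c2_def c1_def norm_mult power2_eq_square algebra_simps flip: abs_mult)
  have s0: "summable (\<lambda>m. cmod (c m))" and s1: "summable (\<lambda>m. cmod (c1 m))"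
    and s2: "summable (\<lambda>m. cmod (c2 m))"
    using l0 l1 l2 by (auto intro: summable_comparison_test'[OF sm, of 0])
  have f: "f = trig_series c n"
    using fourier_series[OF _ cont sm] sob unfolding c_def[abs_def] n_def[abs_def]
    by (auto simp: fun_eq_iff in_sobolev_def L2_torus_def)
  have d0: "(f has_real_derivative trig_series c1 n x) (at x)" for x
    unfolding f c1_def using s1
    by (intro has_derivative_trig_series[OF s0]) (simp add: c1_def norm_mult)
  then have e1: "deriv f = trig_series c1 n" by (auto simp: fun_eq_iff intro: DERIV_imp_deriv)
  have d1: "(deriv f has_real_derivative trig_series c2 n x) (at x)" for x
    unfolding e1 c2_def using s2
    by (intro has_derivative_trig_series[OF s1]) (simp add: c2_def norm_mult)
  then have e2: "deriv (deriv f) = trig_series c2 n" by (auto simp: fun_eq_iff intro: DERIV_imp_deriv)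
  show "(f has_real_derivative deriv f x) (at x)" using d0 e1 by simp
  show "(deriv f has_real_derivative deriv (deriv f) x) (at x)" using d1 e2 by simp
  show "continuous_on UNIV (deriv (deriv f))" unfolding e2 by (rule continuous_on_trig_series[OF s2])
  show "\<bar>f x\<bar> \<le> suminf (fourier_mass f)"
    using abs_trig_series_le[OF sm l0] by (simp add: f)
  show "\<bar>deriv f x\<bar> \<le> suminf (fourier_mass f)"
    unfolding e1 by (rule abs_trig_series_le[OF sm l1])
  show "\<bar>deriv (deriv f) x\<bar> \<le> suminf (fourier_mass f)"
    unfolding e2 by (rule abs_trig_series_le[OF sm l2])
qed

section \<open>Joint continuity in time and space\<close>

lemma continuous_on_Times_uniform:
  fixes w :: "real \<Rightarrow> real \<Rightarrow> real"
  assumes cont: "\<And>t. t \<in> I \<Longrightarrow> continuous_on UNIV (w t)"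
    and le: "\<And>t \<tau> x. t \<in> I \<Longrightarrow> \<tau> \<in> I \<Longrightarrow> \<bar>w \<tau> x - w t x\<bar> \<le> N \<tau> t"
    and lim: "\<And>t. t \<in> I \<Longrightarrow> ((\<lambda>\<tau>. N \<tau> t) \<longlongrightarrow> 0) (at t within I)"
  shows "continuous_on (I \<times> UNIV) (\<lambda>(t, x). w t x)"
  unfolding continuous_on_iff
proof (intro ballI allI impI)
  fix p :: "real \<times> real" and e :: real assume p: "p \<in> I \<times> UNIV" and e: "e > 0"
  obtain t x where tx: "p = (t, x)" by (cases p)
  with p have t: "t \<in> I" by simp
  from cont[OF t] e obtain d1 where d1: "d1 > 0" "\<And>y. dist y x < d1 \<Longrightarrow> dist (w t y) (w t x) < e / 2"
    unfolding continuous_on_iff by (meson UNIV_I half_gt_zero)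
  from tendstoD[OF lim[OF t], of "e / 2"] e obtain d2 where d2: "d2 > 0"
    "\<And>\<tau>. \<tau> \<in> I \<Longrightarrow> \<tau> \<noteq> t \<Longrightarrow> dist \<tau> t < d2 \<Longrightarrow> \<bar>N \<tau> t\<bar> < e / 2"
    by (auto simp: eventually_at)
  have "dist (w \<tau> y) (w t x) < e" if "\<tau> \<in> I" "dist (\<tau>, y) (t, x) < min d1 d2" for \<tau> y
  proof -
    have "dist y x < d1" "dist \<tau> t < d2"
      using that(2) dist_fst_le[of "(\<tau>, y)" "(t, x)"] dist_snd_le[of "(\<tau>, y)" "(t, x)"] by auto
    \<comment> \<open>The limit at \<open>t\<close> says nothing about \<open>\<tau> = t\<close>,
      where the time difference is 0; hence the case split.\<close>
    then have "\<bar>w t y - w t x\<bar> < e / 2" "\<bar>w \<tau> y - w t y\<bar> < e / 2"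
      using d1(2)[of y] d2(2)[of \<tau>] le[OF t \<open>\<tau> \<in> I\<close>, of y] \<open>\<tau> \<in> I\<close> e
      by (auto simp: dist_real_def, cases "\<tau> = t", auto)
    then show ?thesis unfolding dist_real_def by linarith
  qed
  then show "\<exists>d>0. \<forall>q\<in>I \<times> UNIV. dist q p < d \<longrightarrow>
      dist (case q of (t, x) \<Rightarrow> w t x) (case p of (t, x) \<Rightarrow> w t x) < e"
    unfolding tx
    using d1(1) d2(1) by (intro exI[of _ "min d1 d2"]) auto
qed

text \<open>This is the pointwise content of \<open>H3_regular\<close> from which the analysis at
  the origin starts. Continuity up to both end times makes the traces at a fixed point
  bounded.\<close>

definition C2_jet :: "real \<Rightarrow> (real \<Rightarrow> real \<Rightarrow> real) \<Rightarrow> bool" where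
  "C2_jet T v \<longleftrightarrow>
    (\<forall>t\<in>{0..T}. \<forall>x. (v t has_real_derivative deriv (v t) x) (at x) \<and>
      (deriv (v t) has_real_derivative deriv (deriv (v t)) x) (at x)) \<and>
    continuous_on ({0..T} \<times> UNIV) (\<lambda>(t, x). v t x) \<and>
    continuous_on ({0..T} \<times> UNIV) (\<lambda>(t, x). deriv (v t) x) \<and>
    continuous_on ({0..T} \<times> UNIV) (\<lambda>(t, x). deriv (deriv (v t)) x)"

text \<open>Continuity in time with values in H^(11/4) is available because 11/4 < 3. The embedding,
  applied to the difference of \<open>v \<tau>\<close> and \<open>v t\<close>, bounds the
  differences of the derivatives of orders 0, 1 and 2 uniformly in \<open>x\<close> by
  \<open>N \<tau> t\<close>.\<close>

lemma H3_regular_C2_jet: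
  assumes "H3_regular T v"
  shows "C2_jet T v"
proof -
  let ?I = "{0..T}"
  have cont: "continuous_on UNIV (v t)" if "t \<in> ?I" for t
    using assms that by (auto simp: H3_regular_def)
  have C: "C_sobolev T (11/4) v" using assms by (simp add: H3_regular_def)
  then have sob: "in_sobolev (11/4) (v t)" if "t \<in> ?I" for t
    using that by (simp add: C_sobolev_def)
  define N where "N \<tau> t = suminf (fourier_mass (\<lambda>x. v \<tau> x - v t x))" for \<tau> t
  have diff: "continuous_on UNIV (\<lambda>x. v \<tau> x - v t x)" "in_sobolev (11/4) (\<lambda>x. v \<tau> x - v t x)"
    if "t \<in> ?I" "\<tau> \<in> ?I" for t \<tau>
    using that by (auto intro!: in_sobolev_diff cont sob continuous_intros)
  have der: "(v t has_real_derivative deriv (v t) x) (at x)"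
    "(deriv (v t) has_real_derivative deriv (deriv (v t)) x) (at x)" if "t \<in> ?I" for t x
    using sobolev_embedding_C2[OF cont[OF that] sob[OF that]] by auto
  have dd: "deriv (\<lambda>x. v \<tau> x - v t x) = (\<lambda>x. deriv (v \<tau>) x - deriv (v t) x)"
    "deriv (deriv (\<lambda>x. v \<tau> x - v t x)) = (\<lambda>x. deriv (deriv (v \<tau>)) x - deriv (deriv (v t)) x)"
    if "t \<in> ?I" "\<tau> \<in> ?I" for t \<tau>
  proof -
    show 1: "deriv (\<lambda>x. v \<tau> x - v t x) = (\<lambda>x. deriv (v \<tau>) x - deriv (v t) x)"
      using that by (auto simp: fun_eq_iff intro!: DERIV_imp_deriv derivative_intros der)
    show "deriv (deriv (\<lambda>x. v \<tau> x - v t x)) = (\<lambda>x. deriv (deriv (v \<tau>)) x - deriv (deriv (v t)) x)"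
      unfolding 1 using that by (auto simp: fun_eq_iff intro!: DERIV_imp_deriv derivative_intros der)
  qed
  have N: "((\<lambda>\<tau>. N \<tau> t) \<longlongrightarrow> 0) (at t within ?I)" if t: "t \<in> ?I" for t
  proof (rule tendstoI)
    fix e :: real assume e: "e > 0"
    \<comment> \<open>This makes \<open>l * decay_const\<close> smaller than \<open>e / 2\<close>,
      also when \<open>decay_const\<close> is 0; the norm term is then small for
      \<open>\<tau>\<close> near \<open>t\<close>.\<close>
    define l where "l = e / (2 * decay_const + 2)"
    have l: "l > 0" "l * decay_const < e / 2"
      using e decay_const_nonneg by (auto simp: l_def field_simps)
    have "((\<lambda>\<tau>. (sobolev_norm (11/4) (\<lambda>x. v \<tau> x - v t x))\<^sup>2 / l) \<longlongrightarrow> 0\<^sup>2 / l) (at t within ?I)"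
      using C t by (intro tendsto_intros) (use l(1) in \<open>auto simp: C_sobolev_def\<close>)
    then have "\<forall>\<^sub>F \<tau> in at t within ?I. (sobolev_norm (11/4) (\<lambda>x. v \<tau> x - v t x))\<^sup>2 / l < e / 2"
      using e by (intro order_tendstoD(2)[of _ "0\<^sup>2 / l"]) auto
    moreover have "\<forall>\<^sub>F \<tau> in at t within ?I. \<tau> \<in> ?I" by (simp add: eventually_at_filter)
    ultimately show "\<forall>\<^sub>F \<tau> in at t within ?I. dist (N \<tau> t) 0 < e"
    proof eventually_elim
      case (elim \<tau>)
      note b = fourier_mass_bound[OF diff(2)[OF t elim(2)] l(1)]
      have "N \<tau> t \<ge> 0" unfolding N_def by (rule suminf_nonneg[OF b(1)]) (simp add: fourier_mass_def)
      moreover have "N \<tau> t < e" using b(2) elim(1) l(2) unfolding N_def by linarith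
      ultimately show ?case by simp
    qed
  qed
  have c0: "continuous_on (?I \<times> UNIV) (\<lambda>(t, x). v t x)"
    using sobolev_embedding_C2(4)[OF diff] by (intro continuous_on_Times_uniform[of _ _ N] N cont) (auto simp: N_def)
  have contd: "continuous_on UNIV (deriv (v t))" if "t \<in> ?I" for t
    using der(2)[OF that] by (intro DERIV_continuous_on[of _ _ "deriv (deriv (v t))"]) auto
  have c1: "continuous_on (?I \<times> UNIV) (\<lambda>(t, x). deriv (v t) x)"
    using sobolev_embedding_C2(5)[OF diff]
    by (intro continuous_on_Times_uniform[of _ _ N] N contd) (auto simp: N_def dd)
  have le2: "\<bar>deriv (deriv (v \<tau>)) x - deriv (deriv (v t)) x\<bar> \<le> N \<tau> t" if "t \<in> ?I" "\<tau> \<in> ?I" for t \<tau> x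
    using sobolev_embedding_C2(6)[OF diff[OF that]] unfolding dd(2)[OF that] N_def .
  have c2: "continuous_on (?I \<times> UNIV) (\<lambda>(t, x). deriv (deriv (v t)) x)"
    by (intro continuous_on_Times_uniform[of _ _ N] N le2 sobolev_embedding_C2(3)[OF cont sob])
  show ?thesis using c0 c1 c2 der by (auto simp: C2_jet_def)
qed

section \<open>Differential inequalities and uniform limits\<close>

text \<open>\<open>E s * exp (- C * s)\<close> has a nonpositive derivative, so by the mean value
  theorem its value at \<open>t\<close> is at most its value at 0. \<open>E\<close> and
  \<open>C\<close> may have either sign.\<close>

lemma gronwall:
  fixes E :: "real \<Rightarrow> real"
  assumes der: "\<And>t. t \<in> {0..T} \<Longrightarrow> (E has_real_derivative E' t) (at t within {0..T})"
    and le: "\<And>t. t \<in> {0..T} \<Longrightarrow> E' t \<le> C * E t" and t: "t \<in> {0..T}"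
  shows "E t \<le> E 0 * exp (C * t)"
proof (cases "t = 0")
  case False
  define F where "F s = E s * exp (- C * s)" for s
  have "(F has_derivative (*) ((E' s - C * E s) * exp (- C * s))) (at s within {0..t})"
    if "0 \<le> s" "s \<le> t" for s
  proof -
    have "(E has_real_derivative E' s) (at s within {0..t})"
      using der[of s] that t by (auto intro: has_field_derivative_subset)
    then show ?thesis
      unfolding F_def has_field_derivative_def[symmetric]
      by (auto intro!: derivative_eq_intros simp: algebra_simps)
  qed
  from mvt_simple[of 0 t, OF _ this] obtain s where s: "s \<in> {0<..<t}"
    "F t - F 0 = (E' s - C * E s) * exp (- C * s) * (t - 0)"
    using False t by auto
  then have "F t - F 0 \<le> 0"
    using le[of s] t by (auto intro!: mult_nonpos_nonneg)
  then have "F t * exp (C * t) \<le> F 0 * exp (C * t)" by simp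
  then show ?thesis by (simp add: F_def exp_minus divide_simps)
qed simp

lemma gronwall_linear_zero:
  fixes x :: "real \<Rightarrow> real"
  assumes der: "\<And>t. t \<in> {0..T} \<Longrightarrow> (x has_real_derivative A t * x t) (at t within {0..T})"
    and bnd: "bounded (A ` {0..T})" and "x 0 = 0" and t: "t \<in> {0..T}"
  shows "x t = 0"
proof -
  from bnd obtain C where C: "\<And>s. s \<in> {0..T} \<Longrightarrow> \<bar>A s\<bar> \<le> C"
    unfolding bounded_iff by (metis imageI real_norm_def)
  have "(x t)\<^sup>2 \<le> (x 0)\<^sup>2 * exp (2 * C * t)"
  proof (rule gronwall[OF _ _ t])
    fix s assume s: "s \<in> {0..T}"
    show "((\<lambda>t. (x t)\<^sup>2) has_real_derivative 2 * A s * (x s)\<^sup>2) (at s within {0..T})"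
      by (auto intro!: derivative_eq_intros der[OF s] simp: power2_eq_square)
    show "2 * A s * (x s)\<^sup>2 \<le> 2 * C * (x s)\<^sup>2"
      using C[OF s] by (intro mult_right_mono) auto
  qed
  then show ?thesis using \<open>x 0 = 0\<close> by simp
qed

text \<open>Gronwall is applied to x^2 + 1, where the added 1 absorbs the inhomogeneous term through
  2|x| \<le> x^2 + 1. The equation is assumed on closed intervals inside [0, S), as for a solution
  known only below its lifespan, and the bound depends on \<open>S\<close> alone, not on the
  interval.\<close>

lemma linear_ode_bounded:
  fixes x :: "real \<Rightarrow> real"
  assumes der: "\<And>T t. 0 < T \<Longrightarrow> T < S \<Longrightarrow> t \<in> {0..T} \<Longrightarrow>
      (x has_real_derivative A t * x t + B t) (at t within {0..T})"
    and bnd: "bounded (A ` {0..<S})" "bounded (B ` {0..<S})"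
  shows "bounded (x ` {0..<S})"
proof -
  from bnd obtain C D where C: "\<And>s. s \<in> {0..<S} \<Longrightarrow> \<bar>A s\<bar> \<le> C" and D: "\<And>s. s \<in> {0..<S} \<Longrightarrow> \<bar>B s\<bar> \<le> D"
    unfolding bounded_iff by (metis imageI real_norm_def)
  define M where "M = 2 * \<bar>C\<bar> + 2 * \<bar>D\<bar>"
  have "\<bar>x t\<bar> \<le> 1 + ((x 0)\<^sup>2 + 1) * exp (M * S)" if t: "t \<in> {0..<S}" for t
  proof (cases "t = 0")
    \<comment> \<open>The equation is assumed on intervals of positive length, so
      \<open>t = 0\<close> is checked by hand.\<close>
    case True
    have "\<bar>x 0\<bar> \<le> 1 + ((x 0)\<^sup>2 + 1) * 1"
      using sum_squares_bound[of "\<bar>x 0\<bar>" 1] by (simp; linarith)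
    also have "\<dots> \<le> 1 + ((x 0)\<^sup>2 + 1) * exp (M * S)"
      using t by (intro add_left_mono mult_left_mono) (auto simp: M_def)
    finally show ?thesis using True by simp
  next
    case False
    have "(x t)\<^sup>2 + 1 \<le> ((x 0)\<^sup>2 + 1) * exp (M * t)"
    proof (rule gronwall[of t])
      fix s assume s: "s \<in> {0..t}"
      show "((\<lambda>t. (x t)\<^sup>2 + 1) has_real_derivative 2 * x s * (A s * x s + B s)) (at s within {0..t})"
        using der[of t s] False t s by (auto intro!: derivative_eq_intros)
      have "2 * x s * (A s * x s + B s) = 2 * A s * (x s)\<^sup>2 + B s * (2 * x s)"
        by (simp add: algebra_simps power2_eq_square)
      also have "2 * A s * (x s)\<^sup>2 \<le> 2 * \<bar>C\<bar> * (x s)\<^sup>2"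
        using C[of s] s t by (intro mult_right_mono) auto
      also have "B s * (2 * x s) \<le> \<bar>D\<bar> * ((x s)\<^sup>2 + 1)"
      proof -
        have "B s * (2 * x s) \<le> \<bar>B s\<bar> * \<bar>2 * x s\<bar>" by (metis abs_ge_self abs_mult)
        also have "\<dots> \<le> \<bar>D\<bar> * ((x s)\<^sup>2 + 1)"
          using D[of s] s t sum_squares_bound[of "\<bar>x s\<bar>" 1] by (intro mult_mono) (auto simp: abs_mult)
        finally show ?thesis .
      qed
      also have "2 * \<bar>C\<bar> * (x s)\<^sup>2 + \<bar>D\<bar> * ((x s)\<^sup>2 + 1) \<le> M * ((x s)\<^sup>2 + 1)"
        by (simp add: M_def algebra_simps)
      finally show "2 * x s * (A s * x s + B s) \<le> M * ((x s)\<^sup>2 + 1)" by simp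
    qed (use False t in auto)
    also have "\<dots> \<le> ((x 0)\<^sup>2 + 1) * exp (M * S)"
      using t by (intro mult_left_mono) (auto simp: M_def intro!: mult_left_mono)
    finally have "(x t)\<^sup>2 + 1 \<le> ((x 0)\<^sup>2 + 1) * exp (M * S)" .
    moreover have "\<bar>x t\<bar> \<le> (x t)\<^sup>2 + 1"
      using sum_squares_bound[of "\<bar>x t\<bar>" 1] by (simp; linarith)
    ultimately show ?thesis by linarith
  qed
  then show ?thesis unfolding bounded_iff real_norm_def by blast
qed

text \<open>Limits as \<open>h\<close> tends to 0, uniform in time. Boundedness of the limit belongs
  to the notion so that it is stable under products.\<close>

definition ulim :: "real \<Rightarrow> (real \<Rightarrow> real \<Rightarrow> real) \<Rightarrow> (real \<Rightarrow> real) \<Rightarrow> bool" where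
  "ulim T F l \<longleftrightarrow> uniform_limit {0..T} F l (at 0) \<and> bounded (l ` {0..T})"

lemma bounded_image_mult:
  fixes f g :: "'a \<Rightarrow> real"
  assumes "bounded (f ` S)" "bounded (g ` S)"
  shows "bounded ((\<lambda>x. f x * g x) ` S)"
proof -
  from assms obtain C D where "\<And>x. x \<in> S \<Longrightarrow> \<bar>f x\<bar> \<le> C" "\<And>x. x \<in> S \<Longrightarrow> \<bar>g x\<bar> \<le> D"
    unfolding bounded_iff by (metis imageI real_norm_def)
  then have "\<bar>f x * g x\<bar> \<le> \<bar>C\<bar> * \<bar>D\<bar>" if "x \<in> S" for x
    unfolding abs_mult using that by (intro mult_mono) (metis abs_ge_self order_trans abs_ge_zero)+
  then show ?thesis by (auto simp: bounded_iff)
qed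

lemma bounded_image_const: "bounded ((\<lambda>x. c :: real) ` S)"
  by (auto simp: bounded_iff)

lemma ulim_param: "bounded (f ` {0..T}) \<Longrightarrow> ulim T (\<lambda>h. f) f"
  by (simp add: ulim_def uniform_limit_const)

lemma ulim_const: "ulim T (\<lambda>h t. c) (\<lambda>t. c)"
  by (simp add: ulim_def uniform_limit_const bounded_image_const)

lemma ulim_id: "ulim T (\<lambda>h t. h) (\<lambda>t. 0)"
  unfolding ulim_def
  by (auto simp: bounded_image_const eventually_at intro!: uniform_limitI)

lemma ulim_add: "ulim T F l \<Longrightarrow> ulim T G m \<Longrightarrow> ulim T (\<lambda>h t. F h t + G h t) (\<lambda>t. l t + m t)"
  by (auto simp: ulim_def intro!: uniform_limit_intros bounded_plus_comp)

lemma ulim_diff: "ulim T F l \<Longrightarrow> ulim T G m \<Longrightarrow> ulim T (\<lambda>h t. F h t - G h t) (\<lambda>t. l t - m t)"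
  by (auto simp: ulim_def intro!: uniform_limit_intros bounded_minus_comp)

lemma ulim_uminus: "ulim T F l \<Longrightarrow> ulim T (\<lambda>h t. - F h t) (\<lambda>t. - l t)"
  using ulim_diff[OF ulim_const[of T 0]] by simp

lemma ulim_mult: "ulim T F l \<Longrightarrow> ulim T G m \<Longrightarrow> ulim T (\<lambda>h t. F h t * G h t) (\<lambda>t. l t * m t)"
  by (auto simp: ulim_def intro!: uniform_lim_mult bounded_image_mult)

lemma ulim_power: "ulim T F l \<Longrightarrow> ulim T (\<lambda>h t. F h t ^ n) (\<lambda>t. l t ^ n)"
  by (induction n) (auto intro: ulim_const ulim_mult)

lemmas ulim_intros = ulim_const ulim_id ulim_add ulim_diff ulim_uminus ulim_mult ulim_power

lemma ulim_cong:
  assumes "ulim T G l" "\<And>h t. h \<noteq> 0 \<Longrightarrow> t \<in> {0..T} \<Longrightarrow> F h t = G h t" "\<And>t. t \<in> {0..T} \<Longrightarrow> m t = l t"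
  shows "ulim T F m"
proof -
  have "uniform_limit {0..T} F m (at 0) \<longleftrightarrow> uniform_limit {0..T} G l (at 0)"
    using assms by (intro uniform_limit_cong) (auto simp: eventually_at_filter)
  moreover have "m ` {0..T} = l ` {0..T}" using assms(3) by (intro image_cong) auto
  ultimately show ?thesis using assms(1) by (simp add: ulim_def)
qed

lemma bounded_trace:
  fixes g :: "real \<Rightarrow> real \<Rightarrow> real"
  assumes "continuous_on ({0..T} \<times> UNIV) (\<lambda>(t, x). g t x)"
  shows "continuous_on {0..T} (\<lambda>t. g t x)" "bounded ((\<lambda>t. g t x) ` {0..T})"
proof -
  have "continuous_on {0..T} ((\<lambda>(t, x). g t x) \<circ> (\<lambda>t. (t, x)))"
    by (intro continuous_on_compose continuous_intros continuous_on_subset[OF assms]) auto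
  then show "continuous_on {0..T} (\<lambda>t. g t x)" by (simp add: o_def)
  then show "bounded ((\<lambda>t. g t x) ` {0..T})"
    by (intro compact_imp_bounded compact_continuous_image) auto
qed

text \<open>Uniform continuity of \<open>g\<close> on [0, T] x [-1, 1] gives the limit. The form
  fits Lagrange remainders, whose intermediate point depends on \<open>t\<close> in an uncontrolled
  way.\<close>

lemma ulim_intermediate:
  fixes g :: "real \<Rightarrow> real \<Rightarrow> real"
  assumes cont: "continuous_on ({0..T} \<times> UNIV) (\<lambda>(t, x). g t x)"
    and F: "\<And>h t. h \<noteq> 0 \<Longrightarrow> t \<in> {0..T} \<Longrightarrow> \<exists>x. \<bar>x\<bar> \<le> \<bar>h\<bar> \<and> F h t = g t x"
  shows "ulim T F (\<lambda>t. g t 0)"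
proof -
  have "uniformly_continuous_on ({0..T} \<times> {-1..1}) (\<lambda>(t, x). g t x)"
    by (intro compact_uniformly_continuous compact_Times continuous_on_subset[OF cont]) auto
  have "uniform_limit {0..T} F (\<lambda>t. g t 0) (at 0)"
  proof (rule uniform_limitI)
    fix e :: real assume "e > 0"
    with \<open>uniformly_continuous_on _ _\<close> obtain d where d: "d > 0"
      "\<And>p q. p \<in> {0..T} \<times> {-1..1} \<Longrightarrow> q \<in> {0..T} \<times> {-1..1} \<Longrightarrow> dist q p < d \<Longrightarrow>
        dist (case q of (t, x) \<Rightarrow> g t x) (case p of (t, x) \<Rightarrow> g t x) < e"
      unfolding uniformly_continuous_on_def by metis
    have "dist (F h t) (g t 0) < e" if h: "h \<noteq> 0" "dist h 0 < min d 1" and t: "t \<in> {0..T}" for h t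
    proof -
      obtain x where x: "\<bar>x\<bar> \<le> \<bar>h\<bar>" "F h t = g t x" using F[OF h(1) t] by blast
      then show ?thesis
        using d(2)[of "(t, 0)" "(t, x)"] h t by (auto simp: dist_Pair_Pair abs_le_iff)
    qed
    then show "\<forall>\<^sub>F h in at 0. \<forall>t\<in>{0..T}. dist (F h t) (g t 0) < e"
      unfolding eventually_at using d(1) by (intro exI[of _ "min d 1"]) auto
  qed
  then show ?thesis using bounded_trace(2)[OF cont] by (simp add: ulim_def)
qed

section \<open>Taylor quotients at the origin\<close>

lemma ulim_trace:
  assumes "continuous_on ({0..T} \<times> UNIV) (\<lambda>(t, x). g t x)"
  shows "ulim T (\<lambda>h t. g t h) (\<lambda>t. g t 0)"
  by (rule ulim_intermediate[OF assms]) auto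

lemma ulim_first_quotient:
  fixes v v' :: "real \<Rightarrow> real \<Rightarrow> real"
  assumes cont: "continuous_on ({0..T} \<times> UNIV) (\<lambda>(t, x). v' t x)"
    and der: "\<And>t x. t \<in> {0..T} \<Longrightarrow> (v t has_real_derivative v' t x) (at x)"
  shows "ulim T (\<lambda>h t. (v t h - v t 0) / h) (\<lambda>t. v' t 0)"
proof (rule ulim_intermediate[OF cont])
  fix h t :: real assume h: "h \<noteq> 0" and t: "t \<in> {0..T}"
  define D where "D m = (if m = 0 then v t else v' t)" for m :: nat
  have "\<exists>x. \<bar>x\<bar> \<le> \<bar>h\<bar> \<and> v t h = (\<Sum>m<1. D m 0 / fact m * h ^ m) + D 1 x / fact 1 * h ^ 1"
    by (rule Maclaurin_bi_le) (auto simp: D_def der[OF t])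
  then show "\<exists>x. \<bar>x\<bar> \<le> \<bar>h\<bar> \<and> (v t h - v t 0) / h = v' t x"
    using h by (auto simp: D_def)
qed

text \<open>The Lagrange form of the remainder expresses the quotient as half of \<open>v''\<close>
  at an intermediate point.\<close>

lemma ulim_second_quotient:
  fixes v v' v'' :: "real \<Rightarrow> real \<Rightarrow> real"
  assumes cont: "continuous_on ({0..T} \<times> UNIV) (\<lambda>(t, x). v'' t x)"
    and der: "\<And>t x. t \<in> {0..T} \<Longrightarrow> (v t has_real_derivative v' t x) (at x)"
    and der': "\<And>t x. t \<in> {0..T} \<Longrightarrow> (v' t has_real_derivative v'' t x) (at x)"
  shows "ulim T (\<lambda>h t. (v t h - v t 0 - h * v' t 0) / h\<^sup>2) (\<lambda>t. v'' t 0 / 2)"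
proof (rule ulim_intermediate)
  show "continuous_on ({0..T} \<times> UNIV) (\<lambda>(t, x). v'' t x / 2)"
    using cont by (auto intro!: continuous_intros simp: case_prod_beta)
  fix h t :: real assume h: "h \<noteq> 0" and t: "t \<in> {0..T}"
  define D where "D m = (if m = 0 then v t else if m = 1 then v' t else v'' t)" for m :: nat
  have "\<exists>x. \<bar>x\<bar> \<le> \<bar>h\<bar> \<and> v t h = (\<Sum>m<2. D m 0 / fact m * h ^ m) + D 2 x / fact 2 * h ^ 2"
    by (rule Maclaurin_bi_le) (auto simp: D_def der[OF t] der'[OF t] less_2_cases_iff)
  then show "\<exists>x. \<bar>x\<bar> \<le> \<bar>h\<bar> \<and> (v t h - v t 0 - h * v' t 0) / h\<^sup>2 = v'' t x / 2"
    using h by (auto simp: D_def lessThan_nat_numeral lessThan_Suc numeral_2_eq_2)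
qed

text \<open>Uniform convergence of the time derivatives along a sequence of \<open>h\<close> tending
  to 0 lets limit and differentiation be exchanged. This yields time derivatives of space
  derivatives at the origin without differentiating the equations in space.\<close>

lemma ulim_imp_derivative:
  assumes der: "\<And>h t. h \<noteq> 0 \<Longrightarrow> t \<in> {0..T} \<Longrightarrow>
      ((\<lambda>\<tau>. F h \<tau>) has_real_derivative F' h t) (at t within {0..T})"
    and F: "ulim T F l" and F': "ulim T F' l'" and t: "t \<in> {0..T}"
  shows "(l has_real_derivative l' t) (at t within {0..T})"
proof -
  define r where "r n = 1 / real (Suc n)" for n
  have r: "filterlim r (at 0) sequentially"
    unfolding filterlim_at r_def using LIMSEQ_inverse_real_of_nat by (auto simp: inverse_eq_divide)
  have ul: "uniform_limit {0..T} (\<lambda>n. G (r n)) m sequentially" if "ulim T G m" for G m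
    using that filterlim_compose[OF _ r] unfolding ulim_def by blast
  have lim: "(\<lambda>n. F (r n) s) \<longlonglongrightarrow> l s" if "s \<in> {0..T}" for s
    by (rule tendsto_uniform_limitI[OF ul[OF F] that])
  have "\<exists>g. \<forall>x\<in>{0..T}. (\<lambda>n. F (r n) x) \<longlonglongrightarrow> g x \<and>
      (g has_derivative (*) (l' x)) (at x within {0..T})"
  proof (rule has_derivative_sequence[where f = "\<lambda>n. F (r n)" and f' = "\<lambda>n x. (*) (F' (r n) x)"])
    show "(F (r n) has_derivative (*) (F' (r n) x)) (at x within {0..T})" if "x \<in> {0..T}" for n x
      using der[of "r n" x] that unfolding has_field_derivative_def by (simp add: r_def)
    fix e :: real assume "e > 0"
    from uniform_limitD[OF ul[OF F'] this]
    show "\<forall>\<^sub>F n in sequentially. \<forall>x\<in>{0..T}. \<forall>h. norm (F' (r n) x * h - l' x * h) \<le> e * norm h"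
    proof eventually_elim
      case (elim n)
      have "norm (F' (r n) x * h - l' x * h) \<le> e * norm h" if "x \<in> {0..T}" for x h
        using elim that by (simp add: dist_real_def abs_mult mult_right_mono less_imp_le flip: left_diff_distrib)
      then show ?case by blast
    qed
  qed (use t lim[OF t] in auto)
  then obtain g where g: "\<And>x. x \<in> {0..T} \<Longrightarrow> (\<lambda>n. F (r n) x) \<longlonglongrightarrow> g x"
    "\<And>x. x \<in> {0..T} \<Longrightarrow> (g has_real_derivative l' x) (at x within {0..T})"
    unfolding has_field_derivative_def by blast
  have "g x = l x" if "x \<in> {0..T}" for x using LIMSEQ_unique[OF g(1)[OF that] lim[OF that]] .
  then show ?thesis
    using has_field_derivative_transform_within[OF g(2)[OF t] zero_less_one t] by simp
qed

section \<open>Dynamics at the origin\<close>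

lemma C2_jetD:
  assumes "C2_jet T v"
  shows "t \<in> {0..T} \<Longrightarrow> (v t has_real_derivative deriv (v t) x) (at x)"
    and "t \<in> {0..T} \<Longrightarrow> (deriv (v t) has_real_derivative deriv (deriv (v t)) x) (at x)"
    and "continuous_on ({0..T} \<times> UNIV) (\<lambda>(t, x). v t x)"
    and "continuous_on ({0..T} \<times> UNIV) (\<lambda>(t, x). deriv (v t) x)"
    and "continuous_on ({0..T} \<times> UNIV) (\<lambda>(t, x). deriv (deriv (v t)) x)"
  using assms by (auto simp: C2_jet_def)

text \<open>\<open>b\<close> stands for the square root of \<open>k\<close>. Its two derivatives,
  together with its sign, are what forces \<open>k\<close> to vanish to fourth order at the
  origin.\<close>

locale kolmogorov_jets =
  fixes \<nu> \<alpha>1 \<alpha>2 \<alpha>3 \<alpha>4 T :: real and u \<omega> k b :: "real \<Rightarrow> real \<Rightarrow> real"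
  assumes T: "T > 0"
    and ju: "C2_jet T u" and jo: "C2_jet T \<omega>" and jb: "C2_jet T b"
    and pos: "\<And>t x. t \<in> {0..T} \<Longrightarrow> \<omega> t x > 0"
    and bnn: "\<And>t x. t \<in> {0..T} \<Longrightarrow> b t x \<ge> 0"
    and kb: "\<And>t x. t \<in> {0..T} \<Longrightarrow> k t x = (b t x)\<^sup>2"
    and sys: "kolmogorov_system \<nu> \<alpha>1 \<alpha>2 \<alpha>3 \<alpha>4 T u \<omega> k"
    and init: "u 0 0 = 0" "k 0 0 = 0"
begin

text \<open>This is the expanded derivative of \<open>b^2 / \<omega> * w\<close>, with
  \<open>v'\<close> and \<open>v''\<close> standing for \<open>w\<close> and its derivative. Taking
  \<open>w\<close> to be the slope of \<open>u\<close>, \<open>\<omega>\<close> or \<open>k\<close>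
  gives the three diffusion terms.\<close>

definition diffusion :: "real \<Rightarrow> real \<Rightarrow> real \<Rightarrow> real \<Rightarrow> real" where
  "diffusion v' v'' t x =
     (2 * b t x * deriv (b t) x / \<omega> t x - (b t x)\<^sup>2 * deriv (\<omega> t) x / (\<omega> t x)\<^sup>2) * v'
     + (b t x)\<^sup>2 / \<omega> t x * v''"

lemma deriv_flux:
  assumes t: "t \<in> {0..T}" and w: "(w has_real_derivative w') (at x)"
  shows "deriv (\<lambda>y. k t y / \<omega> t y * w y) x = diffusion (w x) w' t x"
proof -
  have "(\<lambda>y. k t y / \<omega> t y * w y) = (\<lambda>y. (b t y)\<^sup>2 / \<omega> t y * w y)"
    using kb[OF t] by simp
  moreover have "((\<lambda>y. (b t y)\<^sup>2 / \<omega> t y * w y) has_real_derivative diffusion (w x) w' t x) (at x)"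
    using pos[OF t, of x] unfolding diffusion_def
    by (auto intro!: derivative_eq_intros C2_jetD(1)[OF jb t] C2_jetD(1)[OF jo t] w
        simp: field_simps power2_eq_square)
  ultimately show ?thesis by (simp add: DERIV_imp_deriv)
qed

lemma deriv_k:
  assumes t: "t \<in> {0..T}"
  shows "deriv (k t) = (\<lambda>x. 2 * b t x * deriv (b t) x)"
    and "((\<lambda>x. 2 * b t x * deriv (b t) x) has_real_derivative
      2 * (deriv (b t) x)\<^sup>2 + 2 * b t x * deriv (deriv (b t)) x) (at x)"
proof -
  have k: "k t = (\<lambda>x. (b t x)\<^sup>2)" using kb[OF t] by auto
  show "deriv (k t) = (\<lambda>x. 2 * b t x * deriv (b t) x)"
    unfolding k
    by (auto simp: fun_eq_iff intro!: DERIV_imp_deriv derivative_eq_intros C2_jetD(1)[OF jb t])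
  show "((\<lambda>x. 2 * b t x * deriv (b t) x) has_real_derivative
      2 * (deriv (b t) x)\<^sup>2 + 2 * b t x * deriv (deriv (b t)) x) (at x)"
    by (auto intro!: derivative_eq_intros C2_jetD[OF jb] t simp: power2_eq_square)
qed

text \<open>The common form of the first two equations, with \<open>c = 0\<close> for
  \<open>u\<close> and \<open>c = \<alpha>2\<close> for \<open>\<omega>\<close>, so that their
  consequences at the origin are derived once.\<close>

definition advects :: "real \<Rightarrow> real \<Rightarrow> (real \<Rightarrow> real \<Rightarrow> real) \<Rightarrow> bool" where
  "advects a c v \<longleftrightarrow> C2_jet T v \<and> (\<forall>t\<in>{0..T}. \<forall>x.
     ((\<lambda>\<tau>. v \<tau> x) has_real_derivative
       - u t x * deriv (v t) x + a * diffusion (deriv (v t) x) (deriv (deriv (v t)) x) t x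
       - c * (v t x)\<^sup>2) (at t within {0..T}))"

lemma advects_u: "advects \<nu> 0 u"
  unfolding advects_def
proof (intro conjI ju ballI allI)
  fix t x assume t: "t \<in> {0..T}"
  obtain ut where ut: "((\<lambda>\<tau>. u \<tau> x) has_real_derivative ut) (at t within {0..T})"
    and eq: "ut + u t x * deriv (u t) x
         - \<nu> * deriv (\<lambda>y. k t y / \<omega> t y * deriv (u t) y) x = 0"
    using sys t unfolding kolmogorov_system_def by blast
  have "ut = - u t x * deriv (u t) x + \<nu> * diffusion (deriv (u t) x) (deriv (deriv (u t)) x) t x
       - 0 * (u t x)\<^sup>2"
    using eq unfolding deriv_flux[OF t C2_jetD(2)[OF ju t]] by simp
  with ut show "((\<lambda>\<tau>. u \<tau> x) has_real_derivative
       - u t x * deriv (u t) x + \<nu> * diffusion (deriv (u t) x) (deriv (deriv (u t)) x) t x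
       - 0 * (u t x)\<^sup>2) (at t within {0..T})" by simp
qed

lemma advects_omega: "advects \<alpha>1 \<alpha>2 \<omega>"
  unfolding advects_def
proof (intro conjI jo ballI allI)
  fix t x assume t: "t \<in> {0..T}"
  obtain ut where ut: "((\<lambda>\<tau>. \<omega> \<tau> x) has_real_derivative ut) (at t within {0..T})"
    and eq: "ut + u t x * deriv (\<omega> t) x
         - \<alpha>1 * deriv (\<lambda>y. k t y / \<omega> t y * deriv (\<omega> t) y) x = - \<alpha>2 * (\<omega> t x)\<^sup>2"
    using sys t unfolding kolmogorov_system_def by blast
  have "ut = - u t x * deriv (\<omega> t) x + \<alpha>1 * diffusion (deriv (\<omega> t) x) (deriv (deriv (\<omega> t)) x) t x
       - \<alpha>2 * (\<omega> t x)\<^sup>2"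
    using eq unfolding deriv_flux[OF t C2_jetD(2)[OF jo t]] by simp
  with ut show "((\<lambda>\<tau>. \<omega> \<tau> x) has_real_derivative
       - u t x * deriv (\<omega> t) x + \<alpha>1 * diffusion (deriv (\<omega> t) x) (deriv (deriv (\<omega> t)) x) t x
       - \<alpha>2 * (\<omega> t x)\<^sup>2) (at t within {0..T})" by simp
qed

text \<open>The third equation is expressed through \<open>b\<close> but kept as an equation for its
  square: one for \<open>b\<close> would require division by \<open>b\<close>, which vanishes at the
  origin.\<close>

definition k_rate :: "real \<Rightarrow> real \<Rightarrow> real" where
  "k_rate t x = - u t x * (2 * b t x * deriv (b t) x)
     + \<alpha>3 * diffusion (2 * b t x * deriv (b t) x)
         (2 * (deriv (b t) x)\<^sup>2 + 2 * b t x * deriv (deriv (b t)) x) t x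
     - (b t x)\<^sup>2 * \<omega> t x + \<alpha>4 * ((b t x)\<^sup>2 / \<omega> t x) * (deriv (u t) x)\<^sup>2"

lemma k_evolution:
  assumes t: "t \<in> {0..T}"
  shows "((\<lambda>\<tau>. (b \<tau> x)\<^sup>2) has_real_derivative k_rate t x) (at t within {0..T})"
proof -
  obtain kt where kt: "((\<lambda>\<tau>. k \<tau> x) has_real_derivative kt) (at t within {0..T})"
    and eq: "kt + u t x * deriv (k t) x
         - \<alpha>3 * deriv (\<lambda>y. k t y / \<omega> t y * deriv (k t) y) x
         = - k t x * \<omega> t x + \<alpha>4 * (k t x / \<omega> t x) * \<bar>deriv (u t) x\<bar>\<^sup>2"
    using sys t unfolding kolmogorov_system_def by blast
  have "kt = k_rate t x"
    using eq unfolding deriv_k(1)[OF t] deriv_flux[OF t deriv_k(2)[OF t]]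
    by (simp add: k_rate_def kb[OF t])
  with kt have "((\<lambda>\<tau>. k \<tau> x) has_real_derivative k_rate t x) (at t within {0..T})" by simp
  then show ?thesis
    by (rule has_field_derivative_transform_within[OF _ zero_less_one t]) (simp add: kb)
qed

section \<open>Vanishing of \<open>u\<close>, \<open>k\<close> and the slope of \<open>b\<close> at
  the origin\<close>

lemmas bounded_at_0 =
  bounded_trace(2)[OF C2_jetD(3)[OF ju], of 0] bounded_trace(2)[OF C2_jetD(4)[OF ju], of 0]
  bounded_trace(2)[OF C2_jetD(5)[OF ju], of 0] bounded_trace(2)[OF C2_jetD(3)[OF jo], of 0]
  bounded_trace(2)[OF C2_jetD(4)[OF jo], of 0] bounded_trace(2)[OF C2_jetD(5)[OF jo], of 0]
  bounded_trace(2)[OF C2_jetD(3)[OF jb], of 0] bounded_trace(2)[OF C2_jetD(4)[OF jb], of 0]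
  bounded_trace(2)[OF C2_jetD(5)[OF jb], of 0]

lemma continuous_inverse_omega: "continuous_on ({0..T} \<times> UNIV) (\<lambda>(t, x). inverse (\<omega> t x))"
  using continuous_on_inverse[OF C2_jetD(3)[OF jo]] pos less_imp_neq[OF pos]
  by (fastforce simp: case_prod_beta)

text \<open>The energy \<open>u\<^sup>2 + k\<close> at the origin dominates all terms of its own time derivative there.\<close>

lemma u_b_zero:
  assumes t: "t \<in> {0..T}"
  shows "u t 0 = 0" "b t 0 = 0"
proof -
  define i where "i t = inverse (\<omega> t 0)" for t
  \<comment> \<open>\<open>P\<close>, \<open>Q\<close> and \<open>R\<close> are the coefficients of
    u^2, u b and b^2 in the derivative of \<open>E\<close>. In the u-equation times 2 u, transport
    gives u^2 and diffusion gives u b; in the k-equation, transport gives u b and all other terms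
    contain b^2.\<close>
  define P where "P t = - 2 * deriv (u t) 0" for t
  define Q where "Q t = 2 * \<nu> * ((2 * deriv (b t) 0 * i t - b t 0 * deriv (\<omega> t) 0 * (i t * i t)) * deriv (u t) 0
      + b t 0 * i t * deriv (deriv (u t)) 0) - 2 * deriv (b t) 0" for t
  define R where "R t = \<alpha>3 * ((2 * deriv (b t) 0 * i t - b t 0 * deriv (\<omega> t) 0 * (i t * i t)) * (2 * deriv (b t) 0)
      + i t * (2 * (deriv (b t) 0 * deriv (b t) 0) + 2 * b t 0 * deriv (deriv (b t)) 0))
      - \<omega> t 0 + \<alpha>4 * i t * (deriv (u t) 0 * deriv (u t) 0)" for t
  define E where "E t = (u t 0)\<^sup>2 + (b t 0)\<^sup>2" for t
  have i: "bounded (i ` {0..T})"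
    using bounded_trace(2)[OF continuous_inverse_omega, of 0] by (simp add: i_def[abs_def])
  have "bounded (P ` {0..T})" "bounded (Q ` {0..T})" "bounded (R ` {0..T})"
    unfolding P_def Q_def R_def
    by (intro bounded_image_mult bounded_plus_comp bounded_minus_comp bounded_image_const
        bounded_at_0 i)+
  then obtain p q r where pqr: "\<And>t. t \<in> {0..T} \<Longrightarrow> \<bar>P t\<bar> \<le> p" "\<And>t. t \<in> {0..T} \<Longrightarrow> \<bar>Q t\<bar> \<le> q"
    "\<And>t. t \<in> {0..T} \<Longrightarrow> \<bar>R t\<bar> \<le> r"
    unfolding bounded_iff by (metis imageI real_norm_def)
  define C where "C = \<bar>p\<bar> + \<bar>q\<bar> + \<bar>r\<bar>"
  have "E t \<le> E 0 * exp (C * t)"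
  proof (rule gronwall[OF _ _ t])
    fix s assume s: "s \<in> {0..T}"
    have nz: "\<omega> s 0 \<noteq> 0" using pos[OF s, of 0] by simp
    let ?E' = "P s * (u s 0)\<^sup>2 + Q s * (u s 0 * b s 0) + R s * (b s 0)\<^sup>2"
    have u': "((\<lambda>\<tau>. u \<tau> 0) has_real_derivative
       - u s 0 * deriv (u s) 0 + \<nu> * diffusion (deriv (u s) 0) (deriv (deriv (u s)) 0) s 0)
       (at s within {0..T})"
      using advects_u s by (simp add: advects_def)
    show "(E has_real_derivative ?E') (at s within {0..T})"
      unfolding E_def
      by (rule derivative_eq_intros u' k_evolution[OF s] refl)+
        (use nz in \<open>simp add: P_def Q_def R_def k_rate_def diffusion_def i_def field_simps power2_eq_square\<close>)
    have "P s * (u s 0)\<^sup>2 \<le> \<bar>p\<bar> * (u s 0)\<^sup>2"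
      using pqr(1)[OF s] by (intro mult_right_mono) auto
    moreover have "R s * (b s 0)\<^sup>2 \<le> \<bar>r\<bar> * (b s 0)\<^sup>2"
      using pqr(3)[OF s] by (intro mult_right_mono) auto
    moreover have "Q s * (u s 0 * b s 0) \<le> \<bar>q\<bar> * ((u s 0)\<^sup>2 + (b s 0)\<^sup>2)"
    proof -
      have "Q s * (u s 0 * b s 0) \<le> \<bar>Q s\<bar> * \<bar>u s 0 * b s 0\<bar>" by (metis abs_ge_self abs_mult)
      also have "\<bar>u s 0 * b s 0\<bar> \<le> (u s 0)\<^sup>2 + (b s 0)\<^sup>2"
      proof -
        have "2 * (\<bar>u s 0\<bar> * \<bar>b s 0\<bar>) \<le> (u s 0)\<^sup>2 + (b s 0)\<^sup>2"
          using sum_squares_bound[of "\<bar>u s 0\<bar>" "\<bar>b s 0\<bar>"] by simp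
        moreover have "0 \<le> \<bar>u s 0\<bar> * \<bar>b s 0\<bar>" by simp
        ultimately show ?thesis unfolding abs_mult by linarith
      qed
      then have "\<bar>Q s\<bar> * \<bar>u s 0 * b s 0\<bar> \<le> \<bar>q\<bar> * ((u s 0)\<^sup>2 + (b s 0)\<^sup>2)"
        using pqr(2)[OF s] by (intro mult_mono) auto
      finally show ?thesis .
    qed
    moreover have "\<bar>p\<bar> * (u s 0)\<^sup>2 + \<bar>q\<bar> * ((u s 0)\<^sup>2 + (b s 0)\<^sup>2) + \<bar>r\<bar> * (b s 0)\<^sup>2 \<le> C * E s"
      by (simp add: C_def E_def algebra_simps)
    ultimately show "?E' \<le> C * E s" by linarith
  qed
  moreover have "E 0 = 0" using init kb[of 0 0] T by (simp add: E_def)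
  ultimately have "(u t 0)\<^sup>2 + (b t 0)\<^sup>2 \<le> 0" by (simp add: E_def)
  then show "u t 0 = 0" "b t 0 = 0" by (auto simp: sum_power2_le_zero_iff)
qed

text \<open>The nonnegative function \<open>\<surd>k\<close> has a minimum at the origin.\<close>

lemma deriv_b_zero:
  assumes t: "t \<in> {0..T}"
  shows "deriv (b t) 0 = 0"
  by (rule DERIV_local_min[OF C2_jetD(1)[OF jb t] zero_less_one])
    (use bnn[OF t] u_b_zero[OF t] in auto)

text \<open>Value and slope of \<open>b\<close> vanish at the origin, so the Taylor quotients reduce
  to these: \<open>b\<close> is of order h^2 and its slope of order h.\<close>

lemma ulim_b:
  shows "ulim T (\<lambda>h t. b t h / h\<^sup>2) (\<lambda>t. deriv (deriv (b t)) 0 / 2)"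
    and "ulim T (\<lambda>h t. deriv (b t) h / h) (\<lambda>t. deriv (deriv (b t)) 0)"
proof -
  show "ulim T (\<lambda>h t. b t h / h\<^sup>2) (\<lambda>t. deriv (deriv (b t)) 0 / 2)"
    by (rule ulim_cong[OF ulim_second_quotient[OF C2_jetD(5,1,2)[OF jb]]])
      (auto simp: u_b_zero deriv_b_zero)
  show "ulim T (\<lambda>h t. deriv (b t) h / h) (\<lambda>t. deriv (deriv (b t)) 0)"
    by (rule ulim_cong[OF ulim_first_quotient[OF C2_jetD(5,2)[OF jb]]])
      (auto simp: deriv_b_zero)
qed

lemmas ulim_inverse_omega = ulim_trace[OF continuous_inverse_omega]

text \<open>The product of \<open>b\<close> and its slope is O(h^3) and b^2 is O(h^4), so
  \<open>?G\<close> is built from convergent factors. The existence of a limit suffices, since the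
  later quotients by h and h^2 leave a positive power of h in front.\<close>

lemma diffusion_cubic:
  assumes "C2_jet T v"
  shows "\<exists>l. ulim T (\<lambda>h t. diffusion (deriv (v t) h) (deriv (deriv (v t)) h) t h / h ^ 3) l"
proof -
  let ?G = "\<lambda>h t. (2 * (b t h / h\<^sup>2) * (deriv (b t) h / h) * inverse (\<omega> t h)
      - h * (b t h / h\<^sup>2)\<^sup>2 * deriv (\<omega> t) h * (inverse (\<omega> t h))\<^sup>2) * deriv (v t) h
      + h * (b t h / h\<^sup>2)\<^sup>2 * inverse (\<omega> t h) * deriv (deriv (v t)) h"
  let ?r = "\<lambda>t. deriv (deriv (b t)) 0" and ?i = "\<lambda>t. inverse (\<omega> t 0)"
  have l: "ulim T ?G (\<lambda>t. (2 * (?r t / 2) * ?r t * ?i t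
      - 0 * (?r t / 2)\<^sup>2 * deriv (\<omega> t) 0 * (?i t)\<^sup>2) * deriv (v t) 0
      + 0 * (?r t / 2)\<^sup>2 * ?i t * deriv (deriv (v t)) 0)"
    by (intro ulim_intros ulim_b ulim_inverse_omega ulim_trace[OF C2_jetD(4)[OF jo]]
        ulim_trace[OF C2_jetD(4)[OF assms]] ulim_trace[OF C2_jetD(5)[OF assms]])
  have "diffusion (deriv (v t) h) (deriv (deriv (v t)) h) t h / h ^ 3 = ?G h t"
    if "h \<noteq> 0" "t \<in> {0..T}" for h t
    using pos[OF that(2), of h] that(1) by (simp add: diffusion_def field_simps eval_nat_numeral)
  from ulim_cong[OF l this refl] show ?thesis by blast
qed

section \<open>Evolution of value, slope and curvature at the origin\<close>

lemma ulim_u_quotient: "ulim T (\<lambda>h t. u t h / h) (\<lambda>t. deriv (u t) 0)"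
  by (rule ulim_cong[OF ulim_first_quotient[OF C2_jetD(4,1)[OF ju]]]) (auto simp: u_b_zero)

text \<open>Transport and diffusion drop out because \<open>u\<close> and \<open>b\<close> vanish at
  the origin.\<close>

lemma value_evolution:
  assumes v: "advects a c v" and t: "t \<in> {0..T}"
  shows "((\<lambda>t. v t 0) has_real_derivative - c * (v t 0)\<^sup>2) (at t within {0..T})"
proof -
  have "((\<lambda>\<tau>. v \<tau> 0) has_real_derivative
       - u t 0 * deriv (v t) 0 + a * diffusion (deriv (v t) 0) (deriv (deriv (v t)) 0) t 0
       - c * (v t 0)\<^sup>2) (at t within {0..T})"
    using v t by (simp add: advects_def)
  then show ?thesis using t by (simp add: diffusion_def u_b_zero)
qed

text \<open>The equation for the first Taylor quotient passes to the limit; diffusion contributes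
  O(h^2). For \<open>v = u\<close> this is the Riccati equation y' = - y^2.\<close>

lemma slope_evolution:
  assumes v: "advects a c v" and t: "t \<in> {0..T}"
  shows "((\<lambda>t. deriv (v t) 0) has_real_derivative
    - deriv (u t) 0 * deriv (v t) 0 - 2 * c * deriv (v t) 0 * v t 0) (at t within {0..T})"
proof (rule ulim_imp_derivative[OF _ _ _ t])
  have jv: "C2_jet T v" using v by (simp add: advects_def)
  let ?D = "\<lambda>t h. diffusion (deriv (v t) h) (deriv (deriv (v t)) h) t h"
  let ?F' = "\<lambda>h t. (- u t h * deriv (v t) h + a * ?D t h - c * (v t h)\<^sup>2 + c * (v t 0)\<^sup>2) / h"
  show quot: "ulim T (\<lambda>h t. (v t h - v t 0) / h) (\<lambda>t. deriv (v t) 0)"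
    by (rule ulim_first_quotient[OF C2_jetD(4,1)[OF jv]])
  show "((\<lambda>t. (v t h - v t 0) / h) has_real_derivative ?F' h t) (at t within {0..T})"
    if "h \<noteq> 0" and s: "t \<in> {0..T}" for h t
  proof -
    have "((\<lambda>\<tau>. v \<tau> h) has_real_derivative
        - u t h * deriv (v t) h + a * ?D t h - c * (v t h)\<^sup>2) (at t within {0..T})"
      using v s by (simp add: advects_def)
    from DERIV_cdivide[OF DERIV_diff[OF this value_evolution[OF v s]], of h]
    show ?thesis by simp
  qed
  obtain l where l: "ulim T (\<lambda>h t. ?D t h / h ^ 3) l" using diffusion_cubic[OF jv] by blast
  show "ulim T ?F' (\<lambda>t. - deriv (u t) 0 * deriv (v t) 0 - 2 * c * deriv (v t) 0 * v t 0)"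
  proof (rule ulim_cong)
    show "ulim T (\<lambda>h t. - (u t h / h) * deriv (v t) h + a * (h\<^sup>2 * (?D t h / h ^ 3))
        - c * ((v t h - v t 0) / h * (v t h + v t 0)))
      (\<lambda>t. - deriv (u t) 0 * deriv (v t) 0 + a * (0\<^sup>2 * l t)
        - c * (deriv (v t) 0 * (v t 0 + v t 0)))"
      by (intro ulim_intros ulim_u_quotient quot l ulim_trace[OF C2_jetD(4)[OF jv]]
          ulim_trace[OF C2_jetD(3)[OF jv]] ulim_param bounded_trace(2)[OF C2_jetD(3)[OF jv]])
  qed (auto simp: field_simps eval_nat_numeral)
qed

text \<open>The same limit is taken for the second Taylor quotient, whose time derivative comes from
  the equation at \<open>h\<close> and the value and slope equations at 0. Diffusion, of order h^3,
  still vanishes after division by h^2.\<close>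

lemma curvature_evolution:
  assumes v: "advects a c v" and t: "t \<in> {0..T}"
  shows "((\<lambda>t. deriv (deriv (v t)) 0) has_real_derivative
    - deriv (deriv (u t)) 0 * deriv (v t) 0 - 2 * deriv (u t) 0 * deriv (deriv (v t)) 0
    - 2 * c * ((deriv (v t) 0)\<^sup>2 + v t 0 * deriv (deriv (v t)) 0)) (at t within {0..T})"
proof -
  have jv: "C2_jet T v" using v by (simp add: advects_def)
  let ?D = "\<lambda>t h. diffusion (deriv (v t) h) (deriv (deriv (v t)) h) t h"
  let ?F' = "\<lambda>h t. (- u t h * deriv (v t) h + a * ?D t h - c * (v t h)\<^sup>2 + c * (v t 0)\<^sup>2
      - h * (- deriv (u t) 0 * deriv (v t) 0 - 2 * c * deriv (v t) 0 * v t 0)) / h\<^sup>2"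
  let ?y = "\<lambda>t. deriv (u t) 0" and ?z = "\<lambda>t. deriv (deriv (u t)) 0"
  let ?p = "\<lambda>t. deriv (v t) 0" and ?q = "\<lambda>t. deriv (deriv (v t)) 0"
  have quot2: "ulim T (\<lambda>h t. (v t h - v t 0 - h * ?p t) / h\<^sup>2) (\<lambda>t. ?q t / 2)"
    by (rule ulim_second_quotient[OF C2_jetD(5,1,2)[OF jv]])
  have quot1: "ulim T (\<lambda>h t. (v t h - v t 0) / h) ?p"
    by (rule ulim_first_quotient[OF C2_jetD(4,1)[OF jv]])
  have quot1': "ulim T (\<lambda>h t. (deriv (v t) h - ?p t) / h) ?q"
    by (rule ulim_first_quotient[OF C2_jetD(5,2)[OF jv]])
  have quotu: "ulim T (\<lambda>h t. (u t h - h * ?y t) / h\<^sup>2) (\<lambda>t. ?z t / 2)"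
    by (rule ulim_cong[OF ulim_second_quotient[OF C2_jetD(5,1,2)[OF ju]]]) (auto simp: u_b_zero)
  have der: "((\<lambda>t. (v t h - v t 0 - h * ?p t) / h\<^sup>2) has_real_derivative ?F' h t) (at t within {0..T})"
    if "h \<noteq> 0" and s: "t \<in> {0..T}" for h t
  proof -
    have "((\<lambda>\<tau>. v \<tau> h) has_real_derivative
        - u t h * deriv (v t) h + a * ?D t h - c * (v t h)\<^sup>2) (at t within {0..T})"
      using v s by (simp add: advects_def)
    from DERIV_cdivide[OF DERIV_diff[OF DERIV_diff[OF this value_evolution[OF v s]]
          DERIV_cmult[OF slope_evolution[OF v s], of h]], of "h\<^sup>2"]
    show ?thesis by simp
  qed
  obtain l where l: "ulim T (\<lambda>h t. ?D t h / h ^ 3) l" using diffusion_cubic[OF jv] by blast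
  have lim: "ulim T ?F' (\<lambda>t. - (?y t * ?q t + ?p t * (?z t / 2)) - c * (?p t * ?p t + ?q t * v t 0))"
  proof (rule ulim_cong)
    \<comment> \<open>Each quotient has a known limit after writing u v' - h y p = u (v' - p) + p (u
      - h y) and v^2 - v0^2 - 2 h p v0 = h p (v - v0) + (v - v0 - h p) (v + v0).\<close>
    show "ulim T (\<lambda>h t. - (u t h / h * ((deriv (v t) h - ?p t) / h) + ?p t * ((u t h - h * ?y t) / h\<^sup>2))
        + a * (h * (?D t h / h ^ 3))
        - c * (?p t * ((v t h - v t 0) / h) + (v t h - v t 0 - h * ?p t) / h\<^sup>2 * (v t h + v t 0)))
      (\<lambda>t. - (?y t * ?q t + ?p t * (?z t / 2)) + a * (0 * l t)
        - c * (?p t * ?p t + ?q t / 2 * (v t 0 + v t 0)))"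
      by (intro ulim_intros ulim_u_quotient quot1 quot2 quot1' quotu l
          ulim_trace[OF C2_jetD(3)[OF jv]] ulim_param bounded_trace(2)[OF C2_jetD(3)[OF jv]]
          bounded_trace(2)[OF C2_jetD(4)[OF jv]])
  qed (auto simp: field_simps eval_nat_numeral)
  \<comment> \<open>The factor 2 undoes the half in the limit of the second Taylor quotient.\<close>
  from DERIV_cmult[OF ulim_imp_derivative[OF der quot2 lim t], of 2]
  have "(?q has_real_derivative
      2 * (- (?y t * ?q t + ?p t * (?z t / 2)) - c * (?p t * ?p t + ?q t * v t 0)))
      (at t within {0..T})" by simp
  then show ?thesis by (rule DERIV_cong) (simp add: algebra_simps power2_eq_square)
qed

text \<open>\<open>k / h^4\<close> tends to a quarter of the squared curvature of \<open>b\<close>,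
  so the k-equation divided by h^4 gives a linear equation for that square, again without dividing
  by \<open>b\<close>.\<close>

lemma curvature_b_evolution:
  assumes t: "t \<in> {0..T}"
  shows "((\<lambda>t. (deriv (deriv (b t)) 0)\<^sup>2) has_real_derivative
    (- 4 * deriv (u t) 0 - \<omega> t 0 + \<alpha>4 * (deriv (u t) 0)\<^sup>2 * inverse (\<omega> t 0)) *
      (deriv (deriv (b t)) 0)\<^sup>2) (at t within {0..T})"
proof -
  let ?r = "\<lambda>t. deriv (deriv (b t)) 0" and ?y = "\<lambda>t. deriv (u t) 0"
  let ?B = "\<lambda>t h. b t h / h\<^sup>2" and ?B' = "\<lambda>t h. deriv (b t) h / h" and ?i = "\<lambda>t h. inverse (\<omega> t h)"
  have F: "ulim T (\<lambda>h t. (b t h)\<^sup>2 / h ^ 4) (\<lambda>t. (?r t / 2)\<^sup>2)"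
    by (rule ulim_cong[OF ulim_power[OF ulim_b(1), of 2]]) (auto simp: power_divide eval_nat_numeral)
  have der: "((\<lambda>t. (b t h)\<^sup>2 / h ^ 4) has_real_derivative k_rate t h / h ^ 4) (at t within {0..T})"
    if "t \<in> {0..T}" for h t
    by (rule DERIV_cdivide[OF k_evolution[OF that]])
  \<comment> \<open>Diffusion of \<open>k\<close> is of order h^6, which leaves the factor h^2; the
    transport and source terms are of order h^4 and survive.\<close>
  let ?G = "\<lambda>h t. - (u t h / h) * (2 * ?B t h * ?B' t h)
      + \<alpha>3 * (h\<^sup>2 * ((2 * ?B t h * ?B' t h * ?i t h
          - h * (?B t h)\<^sup>2 * deriv (\<omega> t) h * (?i t h)\<^sup>2) * (2 * ?B t h * ?B' t h)
        + (?B t h)\<^sup>2 * ?i t h * (2 * (?B' t h)\<^sup>2 + 2 * ?B t h * deriv (deriv (b t)) h)))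
      - (?B t h)\<^sup>2 * \<omega> t h + \<alpha>4 * ((?B t h)\<^sup>2 * ?i t h) * (deriv (u t) h)\<^sup>2"
  have "ulim T (\<lambda>h t. k_rate t h / h ^ 4)
      (\<lambda>t. (- 4 * ?y t - \<omega> t 0 + \<alpha>4 * (?y t)\<^sup>2 * ?i t 0) * (?r t / 2)\<^sup>2)"
  proof (rule ulim_cong)
    show "ulim T ?G (\<lambda>t. - (?y t) * (2 * (?r t / 2) * ?r t)
      + \<alpha>3 * (0\<^sup>2 * ((2 * (?r t / 2) * ?r t * ?i t 0
          - 0 * (?r t / 2)\<^sup>2 * deriv (\<omega> t) 0 * (?i t 0)\<^sup>2) * (2 * (?r t / 2) * ?r t)
        + (?r t / 2)\<^sup>2 * ?i t 0 * (2 * (?r t)\<^sup>2 + 2 * (?r t / 2) * ?r t)))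
      - (?r t / 2)\<^sup>2 * \<omega> t 0 + \<alpha>4 * ((?r t / 2)\<^sup>2 * ?i t 0) * (?y t)\<^sup>2)"
      by (intro ulim_intros ulim_u_quotient ulim_b ulim_inverse_omega
          ulim_trace[OF C2_jetD(3)[OF jo]] ulim_trace[OF C2_jetD(4)[OF jo]]
          ulim_trace[OF C2_jetD(5)[OF jb]] ulim_trace[OF C2_jetD(4)[OF ju]])
    show "k_rate t h / h ^ 4 = ?G h t" if "h \<noteq> 0" "t \<in> {0..T}" for h t
      using pos[OF that(2), of h] that(1)
      by (simp add: k_rate_def diffusion_def field_simps eval_nat_numeral)
  qed (simp add: algebra_simps power2_eq_square)
  from DERIV_cmult[OF ulim_imp_derivative[OF der F this t], of 4]
  show ?thesis by (simp add: power_divide)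
qed

text \<open>The Riccati equation is solved without division: m = (1 + y0 t) y - y0 satisfies m' = -
  y m and starts at 0. In this form the identity also covers times at which 1 + y0 t would vanish,
  which is how the lifespan gets bounded.\<close>

lemma slope_explicit:
  assumes t: "t \<in> {0..T}"
  shows "(1 + deriv (u 0) 0 * t) * deriv (u t) 0 = deriv (u 0) 0"
proof -
  let ?m = "\<lambda>t. (1 + deriv (u 0) 0 * t) * deriv (u t) 0 - deriv (u 0) 0"
  have "?m t = 0"
  proof (rule gronwall_linear_zero[OF _ _ _ t])
    fix s assume s: "s \<in> {0..T}"
    show "(?m has_real_derivative - deriv (u s) 0 * ?m s) (at s within {0..T})"
      by (rule derivative_eq_intros slope_evolution[OF advects_u s] refl)+ (simp add: algebra_simps)
  next
    show "bounded ((\<lambda>t. - deriv (u t) 0) ` {0..T})"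
      using bounded_image_mult[OF bounded_image_const[of "-1"] bounded_at_0(2)] by simp
  qed simp
  then show ?thesis by simp
qed

end

section \<open>Blow-up\<close>

lemma H3_solution_on_jets:
  assumes "H3_solution_on \<nu> \<alpha>1 \<alpha>2 \<alpha>3 \<alpha>4 u0 \<omega>0 k0 T u \<omega> k" "T > 0" "u0 0 = 0" "k0 0 = 0"
  shows "kolmogorov_jets \<nu> \<alpha>1 \<alpha>2 \<alpha>3 \<alpha>4 T u \<omega> k (\<lambda>t x. sqrt (k t x))"
  using assms unfolding H3_solution_on_def
  by unfold_locales (auto intro: H3_regular_C2_jet)

text \<open>\<open>before\<close> says that \<open>S\<close> precedes the Riccati blow-up time when
  the initial slope is negative. The slope of \<open>u\<close>, then \<open>\<omega>\<close> and its
  reciprocal are bounded; the other derivatives follow in order, each from a linear equation whose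
  coefficients are already bounded.\<close>

lemma bounded_at_origin:
  fixes S :: real
  assumes jets: "\<And>T. 0 < T \<Longrightarrow> T < S \<Longrightarrow> kolmogorov_jets \<nu> \<alpha>1 \<alpha>2 \<alpha>3 \<alpha>4 T u \<omega> k b"
    and S: "S > 0" and \<alpha>2: "\<alpha>2 > 0" and before: "1 + deriv (u 0) 0 * S > 0"
    and v: "v \<in> {u, \<omega>, b}" and j: "j \<le> 2"
  shows "bounded ((\<lambda>t. (deriv ^^ j) (v t) 0) ` {0..<S})"
proof -
  let ?I = "{0..<S}"
  define y0 where "y0 = deriv (u 0) 0"
  have ex: "\<exists>T. 0 < T \<and> T < S \<and> t \<in> {0..T}" if "t \<in> ?I" for t
    using that by (intro exI[of _ "(t + S) / 2"]) auto
  note evol = kolmogorov_jets.curvature_evolution[OF jets] kolmogorov_jets.slope_evolution[OF jets]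
    kolmogorov_jets.value_evolution[OF jets]
  note adv = kolmogorov_jets.advects_u[OF jets] kolmogorov_jets.advects_omega[OF jets]
  have pos: "\<omega> t 0 > 0" if "t \<in> ?I" for t
    using ex[OF that] kolmogorov_jets.pos[OF jets] by blast
  have y: "bounded ((\<lambda>t. deriv (u t) 0) ` ?I)"
  proof -
    have "\<bar>deriv (u t) 0\<bar> \<le> \<bar>y0\<bar> / min 1 (1 + y0 * S)" if t: "t \<in> ?I" for t
    proof -
      have eq: "(1 + y0 * t) * deriv (u t) 0 = y0"
        using ex[OF t] kolmogorov_jets.slope_explicit[OF jets] unfolding y0_def by blast
      \<comment> \<open>An affine function on [0, S] is at least the smaller of its end values, here
        1 and \<open>1 + y0 * S\<close>, both positive.\<close>
      have ge: "min 1 (1 + y0 * S) \<le> 1 + y0 * t"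
        using t mult_left_mono_neg[of t S y0] by (cases "y0 \<ge> 0") (auto simp: min_le_iff_disj)
      have "min 1 (1 + y0 * S) * \<bar>deriv (u t) 0\<bar> \<le> (1 + y0 * t) * \<bar>deriv (u t) 0\<bar>"
        by (intro mult_right_mono ge) auto
      also have "\<dots> \<le> \<bar>y0\<bar>" using eq by (metis abs_ge_self abs_mult abs_mult_pos' abs_abs mult_right_mono abs_ge_zero)
      finally show ?thesis using before by (simp add: y0_def field_simps)
    qed
    then show ?thesis unfolding bounded_iff real_norm_def by blast
  qed
  have w: "bounded ((\<lambda>t. \<omega> t 0) ` ?I)"
  proof -
    have "\<omega> t 0 \<le> \<omega> 0 0" if t: "t \<in> ?I" for t
    proof -
      obtain T where T: "0 < T" "T < S" "t \<in> {0..T}" using ex[OF t] by blast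
      \<comment> \<open>Gronwall with constant 0 expresses that \<open>\<omega>\<close> decreases at
        the origin.\<close>
      have "\<omega> t 0 \<le> \<omega> 0 0 * exp (0 * t)"
        by (rule gronwall[OF evol(3)[OF T(1,2) adv(2)[OF T(1,2)]] _ T(3)]) (use \<alpha>2 in auto)
      then show ?thesis by simp
    qed
    then have "\<bar>\<omega> t 0\<bar> \<le> \<omega> 0 0" if "t \<in> ?I" for t using pos[OF that] that by force
    then show ?thesis unfolding bounded_iff real_norm_def by blast
  qed
  \<comment> \<open>The reciprocal turns \<omega>' = - \<alpha>2 \<omega>^2 into growth at the
    constant rate \<alpha>2.\<close>
  have i: "bounded ((\<lambda>t. inverse (\<omega> t 0)) ` ?I)"
  proof (rule linear_ode_bounded[where A = "\<lambda>t. 0" and B = "\<lambda>t. \<alpha>2"])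
    fix T t assume T: "0 < T" "T < S" "t \<in> {0..T}"
    have "\<omega> t 0 > 0" using T by (intro pos) auto
    then show "((\<lambda>t. inverse (\<omega> t 0)) has_real_derivative 0 * inverse (\<omega> t 0) + \<alpha>2) (at t within {0..T})"
      by (auto intro!: derivative_eq_intros evol(3)[OF T(1,2) adv(2)[OF T(1,2)] T(3)]
          simp: field_simps power2_eq_square)
  qed (auto intro: bounded_image_const)
  have z: "bounded ((\<lambda>t. deriv (deriv (u t)) 0) ` ?I)"
  \<comment> \<open>For \<open>v = u\<close> the two transport terms of the curvature equation
    combine into the factor -3.\<close>
  proof (rule linear_ode_bounded[where A = "\<lambda>t. - 3 * deriv (u t) 0" and B = "\<lambda>t. 0"])
    fix T t assume T: "0 < T" "T < S" "t \<in> {0..T}"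
    show "((\<lambda>t. deriv (deriv (u t)) 0) has_real_derivative
        - 3 * deriv (u t) 0 * deriv (deriv (u t)) 0 + 0) (at t within {0..T})"
      by (rule DERIV_cong[OF evol(1)[OF T(1,2) adv(1)[OF T(1,2)] T(3)]]) simp
  qed (intro bounded_image_const bounded_image_mult y)+
  have p: "bounded ((\<lambda>t. deriv (\<omega> t) 0) ` ?I)"
  proof (rule linear_ode_bounded[where A = "\<lambda>t. - 1 * deriv (u t) 0 - 2 * \<alpha>2 * \<omega> t 0" and B = "\<lambda>t. 0"])
    fix T t assume T: "0 < T" "T < S" "t \<in> {0..T}"
    show "((\<lambda>t. deriv (\<omega> t) 0) has_real_derivative
        (- 1 * deriv (u t) 0 - 2 * \<alpha>2 * \<omega> t 0) * deriv (\<omega> t) 0 + 0) (at t within {0..T})"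
      by (rule DERIV_cong[OF evol(2)[OF T(1,2) adv(2)[OF T(1,2)] T(3)]]) (simp add: algebra_simps)
  qed (intro bounded_image_const bounded_image_mult bounded_minus_comp y w)+
  have q: "bounded ((\<lambda>t. deriv (deriv (\<omega> t)) 0) ` ?I)"
  proof (rule linear_ode_bounded[where A = "\<lambda>t. - 2 * deriv (u t) 0 - 2 * \<alpha>2 * \<omega> t 0"
        and B = "\<lambda>t. - 1 * deriv (deriv (u t)) 0 * deriv (\<omega> t) 0 - 2 * \<alpha>2 * (deriv (\<omega> t) 0 * deriv (\<omega> t) 0)"])
    fix T t assume T: "0 < T" "T < S" "t \<in> {0..T}"
    show "((\<lambda>t. deriv (deriv (\<omega> t)) 0) has_real_derivative
        (- 2 * deriv (u t) 0 - 2 * \<alpha>2 * \<omega> t 0) * deriv (deriv (\<omega> t)) 0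
        + (- 1 * deriv (deriv (u t)) 0 * deriv (\<omega> t) 0 - 2 * \<alpha>2 * (deriv (\<omega> t) 0 * deriv (\<omega> t) 0)))
        (at t within {0..T})"
      by (rule DERIV_cong[OF evol(1)[OF T(1,2) adv(2)[OF T(1,2)] T(3)]])
        (simp add: algebra_simps power2_eq_square)
  qed (intro bounded_image_const bounded_image_mult bounded_minus_comp y w z p)+
  have "bounded ((\<lambda>t. (deriv (deriv (b t)) 0)\<^sup>2) ` ?I)"
  proof (rule linear_ode_bounded[where B = "\<lambda>t. 0" and
        A = "\<lambda>t. - 4 * deriv (u t) 0 - \<omega> t 0 + \<alpha>4 * (deriv (u t) 0 * deriv (u t) 0) * inverse (\<omega> t 0)"])
    fix T t assume T: "0 < T" "T < S" "t \<in> {0..T}"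
    show "((\<lambda>t. (deriv (deriv (b t)) 0)\<^sup>2) has_real_derivative
        (- 4 * deriv (u t) 0 - \<omega> t 0 + \<alpha>4 * (deriv (u t) 0 * deriv (u t) 0) * inverse (\<omega> t 0))
        * (deriv (deriv (b t)) 0)\<^sup>2 + 0) (at t within {0..T})"
      by (rule DERIV_cong[OF kolmogorov_jets.curvature_b_evolution[OF jets[OF T(1,2)] T(3)]])
        (simp add: power2_eq_square)
  qed (intro bounded_image_const bounded_image_mult bounded_minus_comp bounded_plus_comp y w i)+
  then obtain M where M: "\<And>t. t \<in> ?I \<Longrightarrow> (deriv (deriv (b t)) 0)\<^sup>2 \<le> M"
    unfolding bounded_iff by (metis imageI real_norm_def abs_power2)
  have r: "bounded ((\<lambda>t. deriv (deriv (b t)) 0) ` ?I)"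
  proof -
    have "\<bar>deriv (deriv (b t)) 0\<bar> \<le> M + 1" if "t \<in> ?I" for t
      using M[OF that] sum_squares_bound[of "\<bar>deriv (deriv (b t)) 0\<bar>" 1] by (simp; linarith)
    then show ?thesis unfolding bounded_iff real_norm_def by blast
  qed
  have zero: "u t 0 = 0" "b t 0 = 0" "deriv (b t) 0 = 0" if "t \<in> ?I" for t
    using ex[OF that] kolmogorov_jets.u_b_zero[OF jets] kolmogorov_jets.deriv_b_zero[OF jets] by blast+
  have null: "bounded ((\<lambda>t. u t 0) ` ?I)" "bounded ((\<lambda>t. b t 0) ` ?I)" "bounded ((\<lambda>t. deriv (b t) 0) ` ?I)"
    using zero by (auto simp: bounded_iff)
  from j consider "j = 0" | "j = 1" | "j = 2" by linarith
  then show ?thesis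
    using v null r q p z w y by cases (auto simp: numeral_2_eq_2)
qed

theorem theorem4p5:
  fixes \<nu> \<alpha>1 \<alpha>2 \<alpha>3 \<alpha>4 \<omega>lo \<omega>hi :: real
    and u0 \<omega>0 k0 :: "real \<Rightarrow> real"
    and u \<omega> k :: "real \<Rightarrow> real \<Rightarrow> real"
  assumes "\<nu> > 0" "\<alpha>1 > 0" "\<alpha>2 > 0" "\<alpha>3 > 0" "\<alpha>4 > 0"
    and "H3_torus u0" "H3_torus \<omega>0" "H3_torus k0"
    and "0 < \<omega>lo" "\<omega>lo \<le> \<omega>hi" "\<And>x. \<omega>lo \<le> \<omega>0 x \<and> \<omega>0 x \<le> \<omega>hi"
    and "\<And>x. k0 x \<ge> 0" "H3_torus (\<lambda>x. sqrt (k0 x))"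
    and "k0 0 = 0"
    and "\<And>x. u0 (- x) = - u0 x" "\<And>x. \<omega>0 (- x) = \<omega>0 x" "\<And>x. k0 (- x) = k0 x"
    and "deriv u0 0 < 0"
    and "H3_solution \<nu> \<alpha>1 \<alpha>2 \<alpha>3 \<alpha>4 u0 \<omega>0 k0 u \<omega> k"
  shows "lifespan \<nu> \<alpha>1 \<alpha>2 \<alpha>3 \<alpha>4 u0 \<omega>0 k0 < \<infinity> \<and>
    (\<not> blows_up_first_away_from (lifespan \<nu> \<alpha>1 \<alpha>2 \<alpha>3 \<alpha>4 u0 \<omega>0 k0) u \<omega> k 0 \<longrightarrow>
      (\<exists>t0>0. lifespan \<nu> \<alpha>1 \<alpha>2 \<alpha>3 \<alpha>4 u0 \<omega>0 k0 = ereal t0 \<and>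
        filterlim (\<lambda>t. deriv (u t) 0) at_bot (at_left t0)))"
proof -
  define L where "L = lifespan \<nu> \<alpha>1 \<alpha>2 \<alpha>3 \<alpha>4 u0 \<omega>0 k0"
  define y0 where "y0 = deriv u0 0"
  \<comment> \<open>The zero of \<open>1 + y0 * t\<close>, where the explicit slope becomes
    singular.\<close>
  define tb where "tb = - 1 / y0"
  have y0: "y0 < 0" using assms(18) by (simp add: y0_def)
  then have tb: "tb > 0" "1 + y0 * tb = 0" by (auto simp: tb_def divide_neg_neg)
  have u00: "u0 0 = 0" using assms(15)[of 0] by simp
  have "L > 0" using assms(19) by (simp add: H3_solution_def L_def)
  have sol: "H3_solution_on \<nu> \<alpha>1 \<alpha>2 \<alpha>3 \<alpha>4 u0 \<omega>0 k0 T u \<omega> k" if "0 < T" "ereal T < L" for T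
    using assms(19) that by (simp add: H3_solution_def L_def)
  have jets: "kolmogorov_jets \<nu> \<alpha>1 \<alpha>2 \<alpha>3 \<alpha>4 T u \<omega> k (\<lambda>t x. sqrt (k t x))"
    if "0 < T" "ereal T < L" for T
    by (rule H3_solution_on_jets[OF sol[OF that] that(1) u00 \<open>k0 0 = 0\<close>])
  have "\<exists>T>0. ereal T < L"
    using ereal_dense2[OF \<open>L > 0\<close>] by (auto simp: zero_ereal_def)
  then have du0: "deriv (u 0) 0 = y0"
    using sol by (auto simp: H3_solution_on_def y0_def)
  have slope: "(1 + y0 * t) * deriv (u t) 0 = y0" if "0 < t" "ereal t < L" for t
    using kolmogorov_jets.slope_explicit[OF jets[OF that], of t] that du0 by simp
  \<comment> \<open>If the solution lived beyond \<open>tb\<close>, the slope identity at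
    \<open>tb\<close> would read \<open>0 = y0\<close>.\<close>
  have "L \<le> ereal tb"
  proof (rule ccontr)
    assume "\<not> L \<le> ereal tb"
    then have "(1 + y0 * tb) * deriv (u tb) 0 = y0" by (intro slope tb) auto
    then show False using tb(2) y0 by simp
  qed
  with \<open>L > 0\<close> obtain S where S: "L = ereal S" "S > 0" "S \<le> tb" by (cases L) auto
  have "\<exists>t0>0. L = ereal t0 \<and> filterlim (\<lambda>t. deriv (u t) 0) at_bot (at_left t0)"
    if "\<not> blows_up_first_away_from L u \<omega> k 0"
  proof -
    from that obtain v j where vj: "v \<in> {u, \<omega>, \<lambda>t x. sqrt (k t x)}" "j \<le> 2"
      "\<not> bounded ((\<lambda>t. (deriv ^^ j) (v t) 0) ` {t. 0 \<le> t \<and> ereal t < L})"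
      unfolding blows_up_first_away_from_def blows_up_at_def using S(1) by auto
    have "{t. 0 \<le> t \<and> ereal t < L} = {0..<S}" using S(1) by auto
    \<comment> \<open>This is \<open>bounded_at_origin\<close> contraposed. With
      \<open>S \<le> tb\<close> it forces \<open>S = tb\<close>.\<close>
    with vj have "\<not> 1 + deriv (u 0) 0 * S > 0"
      using bounded_at_origin[OF jets S(2) \<open>\<alpha>2 > 0\<close> _ vj(1,2)] S(1) by auto
    then have "y0 * S \<le> y0 * tb" using tb(2) du0 by simp
    then have "S = tb" using y0 S(3) by simp
    have ev: "\<forall>\<^sub>F t in at_left tb. 0 < t \<and> t < tb"
      using eventually_at_left_real[OF tb(1)] by (simp add: greaterThanLessThan_def)
    \<comment> \<open>Before \<open>tb\<close> the slope equals y0 / (1 + y0 t), whose denominator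
      tends to 0 through positive values.\<close>
    have "LIM t at_left tb. inverse (1 + y0 * t) :> at_top"
    proof (rule filterlim_inverse_at_top)
      have "((\<lambda>t. 1 + y0 * t) \<longlongrightarrow> 1 + y0 * tb) (at_left tb)" by (intro tendsto_intros)
      then show "((\<lambda>t. 1 + y0 * t) \<longlongrightarrow> 0) (at_left tb)" using tb(2) by simp
      show "\<forall>\<^sub>F t in at_left tb. 0 < 1 + y0 * t"
        using ev
      proof eventually_elim
        case (elim t)
        then have "y0 * tb < y0 * t" using y0 by simp
        then show ?case using tb(2) by linarith
      qed
    qed
    then have "LIM t at_left tb. y0 * inverse (1 + y0 * t) :> at_bot"
      by (rule filterlim_tendsto_neg_mult_at_bot[OF tendsto_const y0])
    moreover have "\<forall>\<^sub>F t in at_left tb. y0 * inverse (1 + y0 * t) = deriv (u t) 0"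
      using ev
    proof eventually_elim
      case (elim t)
      then have "(1 + y0 * t) * deriv (u t) 0 = y0" using S \<open>S = tb\<close> by (intro slope) auto
      moreover from this have "1 + y0 * t \<noteq> 0" using y0 by auto
      ultimately show ?case by (simp add: field_simps)
    qed
    ultimately have "filterlim (\<lambda>t. deriv (u t) 0) at_bot (at_left tb)"
      by (rule filterlim_mono_eventually[OF _ order_refl order_refl])
    then show ?thesis using S(1) \<open>S = tb\<close> tb(1) by blast
  qed
  then show ?thesis using S(1) by (auto simp: L_def)
qed

end
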